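(* Let the saddle-point problem $\min_{x\in\mathcal X}\max_{y\in\mathcal Y}\varphi(x,y)$ be solved by the Mirror Descent scheme described in the context, with Bregman divergence $V_z(w)=\frac12\|z-w\|_2^2$, with the residual-feedback gradient estimator $\tilde g_k$ defined in the context, and with constant step size $\gamma_k=\gamma$. Assume that $\mathcal Z=\mathcal X\times\mathcal Y$ is compact with diameter $\Omega$, that $\varphi$ is convex-concave and is $M$-Lipschitz continuous with respect to $\|\cdot\|_2$ in a certain neighbourhood of $\mathcal Z$, and that the inexact oracle $\tilde\varphi$ satisfies the noise restrictions given in the context. Let $N$ denote the number of iterations and let $\alpha=\frac{6\gamma^2n^2M^2}{\tau^2}<1$. Then $$\mathbb E\left[\varepsilon_{sad}(\bar z_N)\right]\le\frac{3\Omega^2}{2\gamma(N+1)}+\frac{3\gamma}{2(N+1)(1-\alpha)}\mathbb E\left[\|\tilde g_0\|_2^2\right]+\frac{3\gamma}{2(1-\alpha)}\left(\frac{12n^2(\sigma^2+\Delta^2)}{\tau^2}+12n^2M^2\right)+2\tau M+\frac{\Delta\Omega n}{\tau},$$ where $\bar z_N=(\bar x_N,\bar y_N)=\frac1{N+1}\sum_{i=0}^Nz_i$ and $\varepsilon_{sad}(\bar z_N)=\max_{y'\in\mathcal Y}\varphi(\bar x_N,y')-\min_{x'\in\mathcal X}\varphi(x',\bar y_N)$.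
   Context: Setting: $\mathcal X\subset\mathbb R^{n_x}$ and $\mathcal Y\subset\mathbb R^{n_y}$ are compact convex sets, $\mathcal Z=\mathcal X\times\mathcal Y$, $n=n_x+n_y$, $z=(x,y)$ and $\varphi(z)=\varphi(x,y)$. Convex-concave means that $\varphi(\cdot,y)$ is convex on $\mathcal X$ and $\varphi(x,\cdot)$ is concave on $\mathcal Y$. The function $\varphi$ is specified not only on $\mathcal Z$ but in a certain neighbourhood of it, since the points $z+\tau\mathbf e$ with $z\in\mathcal Z$ may lie outside $\mathcal Z$. $M$-Lipschitz continuity ($M>0$) means $|\varphi(z)-\varphi(z')|\le M\|z-z'\|_2$ for $z,z'$ in this neighbourhood. $\Omega$ is the (Euclidean) diameter of $\mathcal Z$. Oracle: only inexact values $\tilde\varphi(z,\xi)=\varphi(z)+\xi+\delta(z)$ are available, where the stochastic noise $\xi$ is generated randomly regardless of the point $z$ and $\delta(z)$ is a deterministic noise depending on the point. Noise restrictions: there exist $\Delta,\sigma>0$ such that $\mathbb E\xi=0$, $\mathbb E[\xi^2]\le\sigma^2$ and $|\delta|\le\Delta$. Estimator: $\tau>0$ is a constant, $\mathbf e_k=((\mathbf e_k)_x,(\mathbf e_k)_y)$ (parts of dimensions $n_x$ and $n_y$) is uniformly distributed on the Euclidean unit sphere of $\mathbb R^n$, and $$\tilde g_k=\frac{n\left(\tilde\varphi(z_k+\tau\mathbf e_k,\xi_k)-\tilde\varphi(z_{k-1}+\tau\mathbf e_{k-1},\xi_{k-1})\right)}{\tau}\begin{pmatrix}(\mathbf e_k)_x\\-(\mathbf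 e_k)_y\end{pmatrix}.$$ Only one new oracle call is needed per iteration. The directions $\mathbf e_k$ and noises $\xi_k$ are generated independently of the previous iterations and of each other. $\tilde g_0$ denotes the estimator used at the first step $k=0$; the formula there refers to a preceding query $(z_{-1},\mathbf e_{-1},\xi_{-1})$, for which no particular choice is prescribed. Scheme: from an input point $z_0$, for $k=0,1,\dots,N$ set $z_{k+1}=\mathrm{prox}_{z_k}(\gamma_k\tilde g_k)$, where $\mathrm{prox}_x(\zeta)=\arg\min_{y\in\mathcal Z}\left(V_x(y)+\langle\zeta,y\rangle\right)$; for $V_z(w)=\frac12\|z-w\|_2^2$ this is the Euclidean projection of $z_k-\gamma_k\tilde g_k$ onto $\mathcal Z$. The output is $\bar z_N$.
   Formalization: Convexity-concavity of φ is assumed on the closed τ-neighbourhood of 𝒵 and not only on 𝒳 and 𝒴; with it only on 𝒵 the bound fails, e.g. 𝒳=[0,1], 𝒴={0}, φ=10x for x<0, φ=−x for x≥0, z_0=0, small γ and τ. *)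

theory Defs
  imports "HOL-Probability.Probability"
begin

text \<open>
  Radial projection of the uniform distribution on the unit ball (the normalised cone measure).
  It is the rotation-invariant probability on the Euclidean unit sphere, i.e. normalised surface
  measure; the origin, where \<^const>\<open>sgn\<close> is not a unit vector, is a null set.
\<close>
definition uniform_sphere :: "'a::euclidean_space measure" where
  "uniform_sphere = distr (uniform_measure lborel (ball 0 1)) borel sgn"

definition closed_neighbourhood :: "real \<Rightarrow> 'a::metric_space set \<Rightarrow> 'a set" where
  "closed_neighbourhood r S = (\<Union>z\<in>S. cball z r)"

text \<open>
  Independence of two random variables; unlike \<^const>\<open>prob_space.indep_var\<close>,
  it allows them to have different value types.
\<close>
definition independent_rvs ::
  "'w measure \<Rightarrow> 'a measure \<Rightarrow> ('w \<Rightarrow> 'a) \<Rightarrow> 'b measure \<Rightarrow> ('w \<Rightarrow> 'b) \<Rightarrow> bool" where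
  "independent_rvs P A f B g \<longleftrightarrow>
     f \<in> measurable P A \<and> g \<in> measurable P B \<and>
     prob_space.indep_set P {f -` S \<inter> space P |S. S \<in> sets A} {g -` S \<inter> space P |S. S \<in> sets B}"

text \<open>
  For \<open>U = X \<times> Y\<close> the nonempty slices are \<open>X\<close> and \<open>Y\<close>, so this is
  convexity on \<open>X\<close> and concavity on \<open>Y\<close>.
\<close>
definition convex_concave_on ::
  "('a::real_vector \<times> 'b::real_vector) set \<Rightarrow> ('a \<times> 'b \<Rightarrow> real) \<Rightarrow> bool" where
  "convex_concave_on U \<phi> \<longleftrightarrow>
     (\<forall>y. convex_on {x. (x, y) \<in> U} (\<lambda>x. \<phi> (x, y))) \<and>
     (\<forall>x. concave_on {y. (x, y) \<in> U} (\<lambda>y. \<phi> (x, y)))"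

definition bregman :: "'a::real_inner \<Rightarrow> 'a \<Rightarrow> real" where
  "bregman z w = 1 / 2 * (norm (z - w))\<^sup>2"

definition prox :: "'a::real_inner set \<Rightarrow> 'a \<Rightarrow> 'a \<Rightarrow> 'a" where
  "prox Z x \<zeta> = (ARG_MIN (\<lambda>y. bregman x y + \<zeta> \<bullet> y) y. y \<in> Z)"

text \<open>
  For \<open>\<phi>\<close> continuous and \<open>X\<close>, \<open>Y\<close> compact and nonempty,
  the supremum and the infimum are attained.
\<close>
definition eps_sad ::
  "'a set \<Rightarrow> 'b set \<Rightarrow> ('a \<times> 'b \<Rightarrow> real) \<Rightarrow> 'a \<times> 'b \<Rightarrow> real" where
  "eps_sad X Y \<phi> z = (SUP y'\<in>Y. \<phi> (fst z, y')) - (INF x'\<in>X. \<phi> (x', snd z))"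

end

theory Submission
  imports Defs
begin

text \<open>
  Write \<open>flip (d\<^sub>x, d\<^sub>y) = (d\<^sub>x, - d\<^sub>y)\<close>. Given the history of step \<open>k\<close>, the direction and the noise are
  fresh, so the conditional mean of the estimator \<open>g k\<close> is a deterministic field \<open>drift\<close> evaluated at
  \<open>z k\<close>: the previous oracle value and the stochastic noise multiply a direction of mean zero.
  Up to the contribution \<open>\<Delta> \<Omega> n / \<tau>\<close> of the deterministic noise, \<open>drift w \<bullet> (w - u)\<close> is
  \<open>n / \<tau>\<close> times the spherical mean of \<open>\<phi> (w + \<tau> d) (flip d \<bullet> (w - u))\<close>. For a function that is convex
  along a segment such a mean dominates the ball average of a finite difference (a weak form of the
  divergence theorem), so it is at least \<open>\<phi> (w\<^sub>x, u\<^sub>y) - \<phi> (u\<^sub>x, w\<^sub>y) - 2 \<tau> M\<close>.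

  The gap maximises over \<open>u\<close> inside the expectation, so \<open>u\<close> may depend on the noise. The errors
  \<open>drift - g\<close> are therefore fed to a second projected descent with the same step: its regret absorbs
  \<open>u\<close>, and what remains is a martingale difference paired with history-measurable vectors, which has
  mean zero. Both regrets are controlled by the second moments of \<open>g k\<close>. These contract with factor
  \<open>\<alpha>\<close> up to a constant, because consecutive iterates differ by at most \<open>\<gamma> \<parallel>g\<parallel>\<close> and consecutive
  directions are uncorrelated.
\<close>

subsection \<open>Directional differences and the uniform distribution on the sphere\<close>

lemma ball_borel_measurable [measurable]:
  "ball (a::'a::metric_space) r \<in> sets borel" "cball a r \<in> sets borel"
  by simp_all

lemma integrable_lborel_bounded_support:
  fixes f :: "'a::euclidean_space \<Rightarrow> real"
  assumes "f \<in> borel_measurable borel" "\<And>p. \<bar>f p\<bar> \<le> B" "\<And>p. r < norm p \<Longrightarrow> f p = 0"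
  shows "integrable lborel f"
  by (rule integrableI_bounded_set[where A = "cball 0 r" and B = B])
     (use assms emeasure_lborel_cball_finite[of 0 r] in auto)

lemma lborel_integral_shift:
  fixes f :: "'a::euclidean_space \<Rightarrow> real"
  assumes [measurable]: "f \<in> borel_measurable borel"
  shows "(\<integral>p. f (p + c) \<partial>lborel) = (\<integral>p. f p \<partial>lborel)"
proof -
  have "(\<integral>p. f p \<partial>lborel) = (\<integral>p. f p \<partial>distr lborel borel ((+) c))"
    by (simp add: lborel_distr_plus)
  also have "\<dots> = (\<integral>p. f (p + c) \<partial>lborel)"
    by (subst integral_distr) (simp_all add: add.commute)
  finally show ?thesis ..
qed

lemma lborel_integral_scaleR:
  fixes f :: "'a::euclidean_space \<Rightarrow> real"
  assumes [measurable]: "f \<in> borel_measurable borel" and "c > 0"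
  shows "(\<integral>p. f p \<partial>lborel) = c ^ DIM('a) * (\<integral>p. f (c *\<^sub>R p) \<partial>lborel)"
proof -
  have "(\<integral>p. f p \<partial>lborel)
      = (\<integral>p. f p \<partial>density (distr lborel borel (\<lambda>x. 0 + c *\<^sub>R x)) (\<lambda>_. \<bar>c\<bar> ^ DIM('a)))"
    using lborel_affine[of c "0 :: 'a"] \<open>c > 0\<close> by simp
  also have "\<dots> = c ^ DIM('a) * (\<integral>p. f (c *\<^sub>R p) \<partial>lborel)"
    using \<open>c > 0\<close> by (subst integral_density) (simp_all add: integral_distr)
  finally show ?thesis .
qed

text \<open>
  Translation invariance moves the difference quotient from the cutoff to \<open>f\<close>, where
  convexity bounds it below by the full difference.
\<close>
lemma cutoff_difference_quotient_ge:
  fixes f \<eta> :: "'a::euclidean_space \<Rightarrow> real"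
  assumes [measurable]: "f \<in> borel_measurable borel" "\<eta> \<in> borel_measurable borel"
    and bound: "\<And>p. \<bar>f p\<bar> \<le> B"
    and convex: "\<And>p t. norm p \<le> 1 \<Longrightarrow> 0 \<le> t \<Longrightarrow> t \<le> 1 \<Longrightarrow>
      f (p - t *\<^sub>R d) \<le> (1 - t) * f p + t * f (p - d)"
    and cutoff: "\<And>p. 0 \<le> \<eta> p" "\<And>p. \<eta> p \<le> 1" "\<And>p. 1 < norm p \<Longrightarrow> \<eta> p = 0"
    and t: "0 < t" "t \<le> 1"
  shows "(\<integral>p. (f p - f (p - d)) * \<eta> p \<partial>lborel) \<le> (\<integral>p. f p * ((\<eta> p - \<eta> (p + t *\<^sub>R d)) / t) \<partial>lborel)"
proof -
  have B: "0 \<le> B" using bound[of 0] by linarith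
  have le: "\<bar>a * \<eta> p\<bar> \<le> \<bar>a\<bar>" for a p
    using cutoff[of p] by (simp add: abs_mult mult_left_le)
  have int: "integrable lborel (\<lambda>p. f (p - c) * \<eta> p)" for c
  proof (rule integrable_lborel_bounded_support[where B = B and r = 1])
    show "\<bar>f (p - c) * \<eta> p\<bar> \<le> B" for p
      using le[of "f (p - c)" p] bound[of "p - c"] by linarith
  qed (simp_all add: cutoff)
  have shift: "(\<integral>p. f p * \<eta> (p + t *\<^sub>R d) \<partial>lborel) = (\<integral>p. f (p - t *\<^sub>R d) * \<eta> p \<partial>lborel)"
    using lborel_integral_shift[of "\<lambda>p. f (p - t *\<^sub>R d) * \<eta> p" "t *\<^sub>R d"] by simp
  have int': "integrable lborel (\<lambda>p. f p * \<eta> (p + t *\<^sub>R d))"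
  proof (rule integrable_lborel_bounded_support[where B = B and r = "1 + norm (t *\<^sub>R d)"])
    show "\<bar>f p * \<eta> (p + t *\<^sub>R d)\<bar> \<le> B" for p
      using le[of "f p" "p + t *\<^sub>R d"] bound[of p] by linarith
    show "f p * \<eta> (p + t *\<^sub>R d) = 0" if "1 + norm (t *\<^sub>R d) < norm p" for p
      using norm_diff_ineq[of p "t *\<^sub>R d"] that cutoff(3)[of "p + t *\<^sub>R d"] by simp
  qed simp
  have "(\<integral>p. (f p - f (p - d)) * \<eta> p \<partial>lborel) \<le> (\<integral>p. (f p * \<eta> p - f (p - t *\<^sub>R d) * \<eta> p) / t \<partial>lborel)"
  proof (rule integral_mono)
    show "integrable lborel (\<lambda>p. (f p - f (p - d)) * \<eta> p)"
      using int[of 0] int[of d] by (simp add: left_diff_distrib)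
    show "integrable lborel (\<lambda>p. (f p * \<eta> p - f (p - t *\<^sub>R d) * \<eta> p) / t)"
      using int[of 0] int[of "t *\<^sub>R d"] by simp
    fix p
    show "(f p - f (p - d)) * \<eta> p \<le> (f p * \<eta> p - f (p - t *\<^sub>R d) * \<eta> p) / t"
    proof (cases "norm p \<le> 1")
      case True
      have "t * (f p - f (p - d)) \<le> f p - f (p - t *\<^sub>R d)"
        using convex[OF True, of t] t by (simp add: algebra_simps)
      then have "(f p - f (p - d)) \<le> (f p - f (p - t *\<^sub>R d)) / t"
        using t by (simp add: field_simps)
      then have "(f p - f (p - d)) * \<eta> p \<le> (f p - f (p - t *\<^sub>R d)) / t * \<eta> p"
        using cutoff(1) by (rule mult_right_mono)
      then show ?thesis by (simp add: left_diff_distrib)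
    qed (simp add: cutoff)
  qed
  also have "\<dots> = ((\<integral>p. f p * \<eta> p \<partial>lborel) - (\<integral>p. f p * \<eta> (p + t *\<^sub>R d) \<partial>lborel)) / t"
    using int[of 0] int[of "t *\<^sub>R d"] shift by simp
  also have "\<dots> = (\<integral>p. (f p * \<eta> p - f p * \<eta> (p + t *\<^sub>R d)) / t \<partial>lborel)"
    using int[of 0] int' by simp
  also have "\<dots> = (\<integral>p. f p * ((\<eta> p - \<eta> (p + t *\<^sub>R d)) / t) \<partial>lborel)"
    by (simp add: algebra_simps diff_divide_distrib)
  finally show ?thesis .
qed

section \<open>Radial cutoff of the unit ball\<close>

text \<open>A Lipschitz substitute for the indicator of the unit ball. It falls linearly from 1 to 0
  on the shell between the radii \<open>1 - \<epsilon>\<close> and 1; its slope 1/\<epsilon> times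
  the volume of that shell stays of order one, which produces the sphere measure in the
  limit.\<close>

definition cutoff :: "real \<Rightarrow> 'a::real_normed_vector \<Rightarrow> real" where
  "cutoff \<epsilon> p = max 0 (min 1 ((1 - norm p) / \<epsilon>))"

lemma cutoff_measurable [measurable]: "cutoff \<epsilon> \<in> borel_measurable borel"
  unfolding cutoff_def[abs_def] by measurable

lemma cutoff_bounds: "0 \<le> cutoff \<epsilon> p" "cutoff \<epsilon> p \<le> 1"
  by (auto simp: cutoff_def)

lemma cutoff_eq_0: "1 \<le> norm p \<Longrightarrow> 0 < \<epsilon> \<Longrightarrow> cutoff \<epsilon> p = 0"
  unfolding cutoff_def by (subst max_absorb1) (auto intro!: min.coboundedI2 divide_nonpos_pos)

lemma cutoff_eq_1: "norm p \<le> 1 - \<epsilon> \<Longrightarrow> 0 < \<epsilon> \<Longrightarrow> cutoff \<epsilon> p = 1"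
  by (auto simp: cutoff_def field_simps)

lemma cutoff_eq: "1 - \<epsilon> \<le> norm p \<Longrightarrow> norm p \<le> 1 \<Longrightarrow> 0 < \<epsilon> \<Longrightarrow> cutoff \<epsilon> p = (1 - norm p) / \<epsilon>"
  by (auto simp: cutoff_def field_simps)

lemma cutoff_lipschitz:
  assumes "0 < \<epsilon>" shows "\<bar>cutoff \<epsilon> p - cutoff \<epsilon> q\<bar> \<le> norm (p - q) / \<epsilon>"
proof -
  have "\<bar>max 0 (min 1 a) - max 0 (min 1 b)\<bar> \<le> \<bar>a - b\<bar>" for a b :: real
    by linarith
  then have "\<bar>cutoff \<epsilon> p - cutoff \<epsilon> q\<bar> \<le> \<bar>(1 - norm p) / \<epsilon> - (1 - norm q) / \<epsilon>\<bar>"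
    unfolding cutoff_def .
  also have "(1 - norm p) / \<epsilon> - (1 - norm q) / \<epsilon> = (norm q - norm p) / \<epsilon>"
    by (simp add: diff_divide_distrib)
  also have "\<bar>(norm q - norm p) / \<epsilon>\<bar> = \<bar>norm p - norm q\<bar> / \<epsilon>"
    using assms by (simp add: abs_divide abs_minus_commute)
  also have "\<dots> \<le> norm (p - q) / \<epsilon>"
    using assms by (intro divide_right_mono norm_triangle_ineq3) auto
  finally show ?thesis .
qed

text \<open>The quotient is minus a one-sided directional derivative, which compensates for the
  cutoff decreasing outwards. The two excluded radii are the kinks; away from them the cutoff is
  locally constant or affine in the norm.\<close>

lemma cutoff_derivative:
  fixes p d :: "'a::euclidean_space"
  assumes "0 < \<epsilon>" "\<epsilon> < 1" "norm p \<noteq> 1" "norm p \<noteq> 1 - \<epsilon>"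
  shows "((\<lambda>t. (cutoff \<epsilon> p - cutoff \<epsilon> (p + t *\<^sub>R d)) / t) \<longlongrightarrow>
           indicator (ball 0 1 - ball 0 (1 - \<epsilon>)) p * (sgn p \<bullet> d) / \<epsilon>) (at_right 0)"
proof -
  let ?U = "{p::'a. norm p < 1 - \<epsilon>}" and ?S = "{p::'a. 1 - \<epsilon> < norm p \<and> norm p < 1}" and ?V = "{p::'a. 1 < norm p}"
  have lim: "((\<lambda>t. p + t *\<^sub>R d) \<longlongrightarrow> p) (at_right 0)"
    by (auto intro!: tendsto_eq_intros)
  have opens: "open ?U" "open ?S" "open ?V"
    by (auto intro!: open_Collect_less open_Collect_conj continuous_intros)
  consider "p \<in> ?U" | "p \<in> ?S" | "p \<in> ?V" using assms by fastforce
  then show ?thesis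
  proof cases
    case 1
    have "\<forall>\<^sub>F t in at_right 0. p + t *\<^sub>R d \<in> ?U"
      by (rule topological_tendstoD[OF lim opens(1) 1])
    then have "\<forall>\<^sub>F t in at_right 0. (cutoff \<epsilon> p - cutoff \<epsilon> (p + t *\<^sub>R d)) / t = 0"
      using 1 assms by (auto elim!: eventually_mono simp: cutoff_eq_1)
    then show ?thesis using 1 by (simp add: tendsto_eventually)
  next
    case 3
    have "\<forall>\<^sub>F t in at_right 0. p + t *\<^sub>R d \<in> ?V"
      by (rule topological_tendstoD[OF lim opens(3) 3])
    then have "\<forall>\<^sub>F t in at_right 0. (cutoff \<epsilon> p - cutoff \<epsilon> (p + t *\<^sub>R d)) / t = 0"
      using 3 assms by (auto elim!: eventually_mono simp: cutoff_eq_0)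
    then show ?thesis using 3 by (simp add: tendsto_eventually)
  next
    case 2
    \<comment> \<open>The norm is differentiable away from the origin, with gradient
      \<open>sgn p\<close>; \<open>\<epsilon> < 1\<close> keeps the shell away from the
      origin.\<close>
    have "p \<noteq> 0" using 2 assms by auto
    have "((\<lambda>t. norm (p + t *\<^sub>R d)) has_derivative (\<lambda>t. (t *\<^sub>R d) \<bullet> sgn p)) (at 0)"
      by (rule has_derivative_compose[where f = "\<lambda>t. p + t *\<^sub>R d" and g = norm, simplified])
         (use has_derivative_norm[OF \<open>p \<noteq> 0\<close>] in \<open>auto intro!: derivative_eq_intros\<close>)
    then have "((\<lambda>t. norm (p + t *\<^sub>R d)) has_real_derivative (sgn p \<bullet> d)) (at 0)"
      unfolding has_field_derivative_def
      by (rule has_derivative_eq_rhs) (auto simp: fun_eq_iff inner_commute)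
    then have "((\<lambda>t. (norm (p + t *\<^sub>R d) - norm p) / t) \<longlongrightarrow> sgn p \<bullet> d) (at 0)"
      by (simp add: DERIV_def)
    then have "((\<lambda>t. (norm (p + t *\<^sub>R d) - norm p) / t) \<longlongrightarrow> sgn p \<bullet> d) (at_right 0)"
      by (rule filterlim_mono) (auto simp: at_le)
    then have *: "((\<lambda>t. (norm (p + t *\<^sub>R d) - norm p) / t / \<epsilon>) \<longlongrightarrow> (sgn p \<bullet> d) / \<epsilon>) (at_right 0)"
      using assms by (intro tendsto_intros) auto
    have "\<forall>\<^sub>F t in at_right 0. p + t *\<^sub>R d \<in> ?S"
      by (rule topological_tendstoD[OF lim opens(2) 2])
    then have "\<forall>\<^sub>F t in at_right 0. (norm (p + t *\<^sub>R d) - norm p) / t / \<epsilon>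
        = (cutoff \<epsilon> p - cutoff \<epsilon> (p + t *\<^sub>R d)) / t"
      using 2 assms by (auto elim!: eventually_mono simp: cutoff_eq simp flip: diff_divide_distrib)
    from tendsto_cong[THEN iffD1, OF this *] show ?thesis using 2 by simp
  qed
qed

text \<open>Spheres are null sets, so the kinks of the cutoff do not disturb limits under the
  integral.\<close>

lemma AE_lborel_norm_neq: "AE p in lborel. norm (p::'a::euclidean_space) \<noteq> r"
proof -
  have "sphere (0::'a) r \<in> null_sets lebesgue"
    using negligible_sphere negligible_iff_null_sets by blast
  then have "sphere (0::'a) r \<in> null_sets lborel"
    by (subst (asm) null_sets_completion_iff) auto
  from AE_not_in[OF this] show ?thesis by simp
qed

text \<open>The limit of \<open>cutoff_difference_quotient_ge\<close> as \<open>t\<close> tends to 0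
  from the right: its left side is independent of \<open>t\<close>, and its right side converges by
  dominated convergence.\<close>

lemma shell_integral_ge:
  fixes f :: "'a::euclidean_space \<Rightarrow> real"
  assumes [measurable]: "f \<in> borel_measurable borel"
    and bound: "\<And>p. \<bar>f p\<bar> \<le> B"
    and convex: "\<And>p t. norm p \<le> 1 \<Longrightarrow> 0 \<le> t \<Longrightarrow> t \<le> 1 \<Longrightarrow>
      f (p - t *\<^sub>R d) \<le> (1 - t) * f p + t * f (p - d)"
    and \<epsilon>: "0 < \<epsilon>" "\<epsilon> < 1"
  shows "(\<integral>p. (f p - f (p - d)) * cutoff \<epsilon> p \<partial>lborel)
    \<le> (\<integral>p. f p * (indicator (ball 0 1 - ball 0 (1 - \<epsilon>)) p * (sgn p \<bullet> d) / \<epsilon>) \<partial>lborel)"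
proof -
  define t where "t i = 1 / real (Suc i)" for i
  have t: "0 < t i" "t i \<le> 1" for i by (auto simp: t_def)
  have "t \<longlonglongrightarrow> 0" unfolding t_def[abs_def] by (rule LIMSEQ_Suc[OF lim_1_over_n])
  then have t_lim: "filterlim t (at_right 0) sequentially"
    using t(1) by (simp add: filterlim_at less_imp_neq[symmetric] always_eventually)
  have B: "0 \<le> B" using bound[of 0] by linarith
  have "(\<lambda>i. \<integral>p. f p * ((cutoff \<epsilon> p - cutoff \<epsilon> (p + t i *\<^sub>R d)) / t i) \<partial>lborel)
    \<longlonglongrightarrow> (\<integral>p. f p * (indicator (ball 0 1 - ball 0 (1 - \<epsilon>)) p * (sgn p \<bullet> d) / \<epsilon>) \<partial>lborel)"
  proof (rule integral_dominated_convergence)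
    \<comment> \<open>The Lipschitz constant 1/\<epsilon> of the cutoff bounds the quotients. Since
      \<open>t i \<le> 1\<close>, they vanish outside the ball of radius
      \<open>1 + norm d\<close>.\<close>
    show "integrable lborel (\<lambda>p::'a. B * (norm d / \<epsilon>) * indicator (cball 0 (1 + norm d)) p)"
      using emeasure_lborel_cball_finite[of "0 :: 'a" "1 + norm d"]
      by (intro integrable_mult_right integrable_real_indicator) auto
    show "AE p in lborel. (\<lambda>i. f p * ((cutoff \<epsilon> p - cutoff \<epsilon> (p + t i *\<^sub>R d)) / t i))
      \<longlonglongrightarrow> f p * (indicator (ball 0 1 - ball 0 (1 - \<epsilon>)) p * (sgn p \<bullet> d) / \<epsilon>)"
      using AE_lborel_norm_neq[of 1] AE_lborel_norm_neq[of "1 - \<epsilon>"]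
    proof eventually_elim
      case (elim p)
      show ?case
        by (intro tendsto_mult_left filterlim_compose[OF cutoff_derivative t_lim] elim \<epsilon>)
    qed
    show "AE p in lborel. norm (f p * ((cutoff \<epsilon> p - cutoff \<epsilon> (p + t i *\<^sub>R d)) / t i))
      \<le> B * (norm d / \<epsilon>) * indicator (cball 0 (1 + norm d)) p" for i
    proof (intro AE_I2)
      fix p :: 'a
      let ?D = "(cutoff \<epsilon> p - cutoff \<epsilon> (p + t i *\<^sub>R d)) / t i"
      have "\<bar>cutoff \<epsilon> p - cutoff \<epsilon> (p + t i *\<^sub>R d)\<bar> \<le> t i * (norm d / \<epsilon>)"
        using cutoff_lipschitz[OF \<epsilon>(1), of p "p + t i *\<^sub>R d"] t(1)[of i] by simp
      then have D: "\<bar>?D\<bar> \<le> norm d / \<epsilon>"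
        using t(1)[of i] by (simp add: abs_divide divide_le_eq mult.commute)
      have "?D = 0" if "1 + norm d < norm p"
      proof -
        have "norm (t i *\<^sub>R d) \<le> norm d"
          using t[of i] by (simp add: mult_left_le_one_le)
        then have "1 \<le> norm (p + t i *\<^sub>R d)" "1 \<le> norm p"
          using norm_diff_ineq[of p "t i *\<^sub>R d"] that norm_ge_zero[of d] by linarith+
        then show ?thesis using \<epsilon> by (simp add: cutoff_eq_0)
      qed
      moreover have "\<bar>f p\<bar> * \<bar>?D\<bar> \<le> B * (norm d / \<epsilon>)"
        by (rule mult_mono) (use bound D B in auto)
      ultimately show "norm (f p * ?D) \<le> B * (norm d / \<epsilon>) * indicator (cball 0 (1 + norm d)) p"
        by (cases "1 + norm d < norm p") (auto simp: abs_mult)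
    qed
  qed simp_all
  moreover have "(\<integral>p. (f p - f (p - d)) * cutoff \<epsilon> p \<partial>lborel)
      \<le> (\<integral>p. f p * ((cutoff \<epsilon> p - cutoff \<epsilon> (p + t i *\<^sub>R d)) / t i) \<partial>lborel)" for i
    by (rule cutoff_difference_quotient_ge[where B = B])
       (use assms(1) bound convex cutoff_bounds cutoff_eq_0[OF less_imp_le] \<epsilon> t in auto)
  ultimately show ?thesis
    by (intro LIMSEQ_le_const) auto
qed

section \<open>Integrals of functions of the direction over balls and shells\<close>

text \<open>\<open>sgn\<close> is invariant under positive dilations, so rescaling the ball leaves
  only the Jacobian.\<close>

lemma integral_ball_sgn:
  fixes F :: "'a::euclidean_space \<Rightarrow> real"
  assumes [measurable]: "F \<in> borel_measurable borel" and "0 < r"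
  shows "(\<integral>p. indicator (ball 0 r) p * F (sgn p) \<partial>lborel)
    = r ^ DIM('a) * (\<integral>p. indicator (ball 0 1) p * F (sgn p) \<partial>lborel)"
proof -
  have "indicator (ball 0 r) (r *\<^sub>R p) = (indicator (ball 0 1) p :: real)" for p :: 'a
    using \<open>0 < r\<close> by (auto simp: indicator_def)
  then show ?thesis
    using \<open>0 < r\<close> by (subst lborel_integral_scaleR[OF _ \<open>0 < r\<close>]) (simp_all add: sgn_scaleR)
qed

text \<open>The shell is a difference of two concentric balls, to each of which the scaling rule
  applies.\<close>

lemma integral_shell_sgn:
  fixes F :: "'a::euclidean_space \<Rightarrow> real"
  assumes [measurable]: "F \<in> borel_measurable borel" and "\<And>p. \<bar>F p\<bar> \<le> B" and "0 < \<epsilon>" "\<epsilon> < 1"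
  shows "(\<integral>p. indicator (ball 0 1 - ball 0 (1 - \<epsilon>)) p * F (sgn p) \<partial>lborel)
    = (1 - (1 - \<epsilon>) ^ DIM('a)) * (\<integral>p. indicator (ball 0 1) p * F (sgn p) \<partial>lborel)"
proof -
  have [simp]: "integrable lborel (\<lambda>p. indicator (ball 0 r) p * F (sgn p))" for r
  proof (rule integrable_lborel_bounded_support[where B = B and r = r])
    show "\<bar>indicator (ball 0 r) p * F (sgn p)\<bar> \<le> B" for p
      using assms(2)[of "sgn p"] by (auto simp: indicator_def)
  qed auto
  have "(\<integral>p. indicator (ball 0 1 - ball 0 (1 - \<epsilon>)) p * F (sgn p) \<partial>lborel)
    = (\<integral>p. indicator (ball 0 1) p * F (sgn p) - indicator (ball 0 (1 - \<epsilon>)) p * F (sgn p) \<partial>lborel)"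
    using \<open>0 < \<epsilon>\<close> by (intro Bochner_Integration.integral_cong) (auto simp: indicator_def)
  also have "\<dots> = (1 - (1 - \<epsilon>) ^ DIM('a)) * (\<integral>p. indicator (ball 0 1) p * F (sgn p) \<partial>lborel)"
    using integral_ball_sgn[of F "1 - \<epsilon>"] assms by (simp add: left_diff_distrib)
  finally show ?thesis .
qed

lemma integral_uniform_measure:
  fixes f :: "'a \<Rightarrow> real"
  assumes [measurable]: "f \<in> borel_measurable M" "A \<in> sets M" and "emeasure M A \<noteq> 0" "emeasure M A \<noteq> \<infinity>"
  shows "(\<integral>x. f x \<partial>uniform_measure M A) = (\<integral>x. indicator A x * f x \<partial>M) / measure M A"
proof -
  have pos: "0 < measure M A" and eq: "emeasure M A = ennreal (measure M A)"
    using assms by (auto simp: measure_def enn2real_positive_iff top.not_eq_extremum zero_less_iff_neq_zero)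
  have "indicator A x / emeasure M A = ennreal (indicator A x / measure M A)" for x
    unfolding eq using pos by (auto simp: indicator_def divide_ennreal simp flip: ennreal_1)
  then have "(\<integral>x. f x \<partial>uniform_measure M A) = (\<integral>x. indicator A x / measure M A * f x \<partial>M)"
    unfolding uniform_measure_def by (simp add: integral_density)
  also have "\<dots> = (\<integral>x. indicator A x * f x / measure M A \<partial>M)"
    by (intro Bochner_Integration.integral_cong) auto
  finally show ?thesis by simp
qed

lemma emeasure_unit_ball: "emeasure lborel (ball (0::'a::euclidean_space) 1) \<noteq> 0"
    "emeasure lborel (ball (0::'a) 1) \<noteq> \<infinity>"
  using emeasure_lborel_ball_finite[of "0::'a" 1]
    open_not_negligible[of "ball (0::'a) 1"] negligible_iff_emeasure0[of "ball (0::'a) 1"]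
  by (auto simp: top.not_eq_extremum)

lemma integral_uniform_sphere:
  fixes F :: "'a::euclidean_space \<Rightarrow> real"
  assumes [measurable]: "F \<in> borel_measurable borel"
  shows "(\<integral>e. F e \<partial>uniform_sphere)
    = (\<integral>p. indicator (ball 0 1) p * F (sgn p) \<partial>lborel) / measure lborel (ball (0::'a) 1)"
proof -
  have "(\<integral>e. F e \<partial>uniform_sphere) = (\<integral>p. F (sgn p) \<partial>uniform_measure lborel (ball 0 1))"
    unfolding uniform_sphere_def by (subst integral_distr) simp_all
  also have "\<dots> = (\<integral>p. indicator (ball 0 1) p * F (sgn p) \<partial>lborel) / measure lborel (ball (0::'a) 1)"
    by (rule integral_uniform_measure[OF _ _ emeasure_unit_ball]) simp_all
  finally show ?thesis .
qed

text \<open>Relative volume of the shell per unit of width. This is where the dimension factor in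
  front of the sphere integral, and hence the factor \<open>n\<close> of the estimator, comes
  from.\<close>

lemma power_difference_quotient:
  "((\<lambda>\<epsilon>. (1 - (1 - \<epsilon>) ^ n) / \<epsilon>) \<longlongrightarrow> real n) (at (0::real))"
proof -
  have "((\<lambda>\<epsilon>. 1 - (1 - \<epsilon>) ^ n) has_real_derivative real n) (at (0::real))"
    by (auto intro!: derivative_eq_intros)
  then show ?thesis by (simp add: DERIV_def)
qed

text \<open>
  As \<open>\<epsilon>\<close> tends to 0, the cutoff tends to the indicator of the ball and its derivative,
  supported on a shell of width \<open>\<epsilon>\<close>, to the cone measure of the sphere.
\<close>
lemma uniform_sphere_directional_ge:
  fixes f :: "'a::euclidean_space \<Rightarrow> real"
  assumes [measurable]: "f \<in> borel_measurable borel"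
    and bound: "\<And>p. \<bar>f p\<bar> \<le> B"
    and lip: "L-lipschitz_on (cball 0 1) f"
    and convex: "\<And>p t. norm p \<le> 1 \<Longrightarrow> 0 \<le> t \<Longrightarrow> t \<le> 1 \<Longrightarrow>
      f (p - t *\<^sub>R d) \<le> (1 - t) * f p + t * f (p - d)"
  shows "(\<integral>p. f p - f (p - d) \<partial>uniform_measure lborel (ball 0 1))
    \<le> real DIM('a) * (\<integral>e. f e * (e \<bullet> d) \<partial>uniform_sphere)"
proof -
  let ?B = "ball (0::'a) 1"
  define A where "A = (\<integral>p. indicator ?B p * (f (sgn p) * (sgn p \<bullet> d)) \<partial>lborel)"
  define V where "V = (\<integral>p. indicator ?B p * 1 \<partial>lborel :: real)"
  \<comment> \<open>The double successor keeps the width strictly below 1 already for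
    \<open>i = 0\<close>.\<close>
  define \<epsilon> where "\<epsilon> i = 1 / real (Suc (Suc i))" for i
  define c where "c i = 1 - (1 - \<epsilon> i) ^ DIM('a)" for i
  have \<epsilon>: "0 < \<epsilon> i" "\<epsilon> i < 1" for i by (auto simp: \<epsilon>_def)
  have "\<epsilon> \<longlonglongrightarrow> 0" unfolding \<epsilon>_def[abs_def] by (intro LIMSEQ_Suc lim_1_over_n)
  then have \<epsilon>_lim: "filterlim \<epsilon> (at 0) sequentially"
    using \<epsilon>(1) by (simp add: filterlim_at less_imp_neq[symmetric] always_eventually)
  have "0 \<le> B" using bound[of 0] by linarith
  have "0 \<le> L" using lip by (rule lipschitz_on_nonneg)
  have fd: "\<bar>f p * (sgn p \<bullet> d)\<bar> \<le> B * norm d" "\<bar>f (sgn p) * (sgn p \<bullet> d)\<bar> \<le> B * norm d" for p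
  proof -
    have "\<bar>sgn p \<bullet> d\<bar> \<le> 1 * norm d"
      by (rule order_trans[OF Cauchy_Schwarz_ineq2]) (intro mult_right_mono, auto simp: norm_sgn)
    then show "\<bar>f p * (sgn p \<bullet> d)\<bar> \<le> B * norm d" "\<bar>f (sgn p) * (sgn p \<bullet> d)\<bar> \<le> B * norm d"
      unfolding abs_mult using bound \<open>0 \<le> B\<close> by (auto intro!: mult_mono)
  qed
  \<comment> \<open>On the shell \<open>f p\<close> is replaced by \<open>f (sgn p)\<close> at a
    cost of at most \<open>L * \<epsilon> i\<close>, the two points being
    \<open>\<epsilon> i\<close> close. The shell has volume \<open>c i * V\<close>; after division
    by the width the error is the last summand, which tends to 0 with \<open>c i\<close>.\<close>
  have shell: "(\<integral>p. (f p - f (p - d)) * cutoff (\<epsilon> i) p \<partial>lborel) \<le> c i / \<epsilon> i * A + L * norm d * c i * V" for i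
  proof -
    let ?S = "?B - ball 0 (1 - \<epsilon> i)"
    have int: "integrable lborel (\<lambda>p. indicator ?S p * F p)"
      if "F \<in> borel_measurable borel" "\<And>p. \<bar>F p\<bar> \<le> K" for F and K :: real
    proof (rule integrable_lborel_bounded_support[where B = K and r = 1])
      show "\<bar>indicator ?S p * F p\<bar> \<le> K" for p
        using that(2)[of p] by (auto simp: indicator_def)
    qed (use that(1) in auto)
    have "(\<integral>p. (f p - f (p - d)) * cutoff (\<epsilon> i) p \<partial>lborel)
        \<le> (\<integral>p. f p * (indicator ?S p * (sgn p \<bullet> d) / \<epsilon> i) \<partial>lborel)"
      by (rule shell_integral_ge[OF assms(1) bound convex \<epsilon>])
    also have "\<dots> = (\<integral>p. indicator ?S p * (f p * (sgn p \<bullet> d)) \<partial>lborel) / \<epsilon> i"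
      by (simp add: mult.left_commute flip: integral_divide_zero)
    also have "\<dots> \<le> (\<integral>p. indicator ?S p * (f (sgn p) * (sgn p \<bullet> d)) + indicator ?S p * (L * norm d * \<epsilon> i) \<partial>lborel) / \<epsilon> i"
    proof (intro divide_right_mono integral_mono Bochner_Integration.integrable_add)
      show "integrable lborel (\<lambda>p. indicator ?S p * (f p * (sgn p \<bullet> d)))"
        "integrable lborel (\<lambda>p. indicator ?S p * (f (sgn p) * (sgn p \<bullet> d)))"
        by (rule int[OF _ fd(1)] int[OF _ fd(2)], measurable)+
      show "integrable lborel (\<lambda>p. indicator ?S p * (L * norm d * \<epsilon> i))"
        by (rule int) auto
      fix p
      show "indicator ?S p * (f p * (sgn p \<bullet> d))
        \<le> indicator ?S p * (f (sgn p) * (sgn p \<bullet> d)) + indicator ?S p * (L * norm d * \<epsilon> i)"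
      proof (cases "p \<in> ?S")
        case True
        then have p: "norm p < 1" "1 - \<epsilon> i \<le> norm p" "p \<noteq> 0" using \<epsilon>[of i] by auto
        have "p = norm p *\<^sub>R sgn p" using p by (simp add: sgn_div_norm)
        then have "norm (p - sgn p) = norm ((norm p - 1) *\<^sub>R sgn p)"
          by (simp add: algebra_simps)
        also have "\<dots> = 1 - norm p" using p by (simp add: norm_sgn)
        finally have "norm (p - sgn p) \<le> \<epsilon> i" using p by simp
        moreover have "\<bar>f p - f (sgn p)\<bar> \<le> L * norm (p - sgn p)"
          using lipschitz_onD[OF lip, of p "sgn p"] p by (simp add: dist_norm norm_sgn)
        ultimately have 1: "\<bar>f p - f (sgn p)\<bar> \<le> L * \<epsilon> i"
          using \<open>0 \<le> L\<close> by (meson mult_left_mono order_trans)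
        have 2: "\<bar>sgn p \<bullet> d\<bar> \<le> norm d"
          using Cauchy_Schwarz_ineq2[of "sgn p" d] p by (simp add: norm_sgn)
        have "(f p - f (sgn p)) * (sgn p \<bullet> d) \<le> \<bar>f p - f (sgn p)\<bar> * \<bar>sgn p \<bullet> d\<bar>"
          by (simp flip: abs_mult)
        also have "\<dots> \<le> L * \<epsilon> i * norm d"
          using 1 2 \<open>0 \<le> L\<close> \<epsilon>(1)[of i] by (intro mult_mono) auto
        finally show ?thesis using True by (simp add: algebra_simps)
      qed simp
    qed (use \<epsilon>(1)[of i] in auto)
    also have "\<dots> = ((\<integral>p. indicator ?S p * (f (sgn p) * (sgn p \<bullet> d)) \<partial>lborel) + (\<integral>p. indicator ?S p * (L * norm d * \<epsilon> i) \<partial>lborel)) / \<epsilon> i"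
      by (subst Bochner_Integration.integral_add[OF int[OF _ fd(2)] int]) (auto simp del: integral_mult_left_zero)
    also have "(\<integral>p. indicator ?S p * (f (sgn p) * (sgn p \<bullet> d)) \<partial>lborel) = c i * A"
    proof -
      \<comment> \<open>Truncation to the closed unit ball makes \<open>F\<close> globally bounded,
        as \<open>integral_shell_sgn\<close> demands. All values of \<open>sgn\<close> lie in that
        ball, so the integrals are unaffected.\<close>
      define F where "F e = f e * (e \<bullet> d) * indicator (cball 0 1) e" for e
      have [measurable]: "F \<in> borel_measurable borel" unfolding F_def[abs_def] by measurable
      have "\<bar>F e\<bar> \<le> B * norm d" for e
      proof (cases "e \<in> cball 0 1")
        case True
        then have "\<bar>e \<bullet> d\<bar> \<le> 1 * norm d"
          by (intro order_trans[OF Cauchy_Schwarz_ineq2] mult_right_mono) auto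
        then show ?thesis unfolding F_def abs_mult using bound \<open>0 \<le> B\<close> True by (auto intro!: mult_mono)
      qed (use \<open>0 \<le> B\<close> in \<open>simp add: F_def\<close>)
      moreover have "F (sgn p) = f (sgn p) * (sgn p \<bullet> d)" for p
        by (auto simp: F_def norm_sgn)
      ultimately show ?thesis
        using integral_shell_sgn[of F "B * norm d" "\<epsilon> i"] \<epsilon>[of i] by (simp add: A_def c_def)
    qed
    also have "(\<integral>p. indicator ?S p * (L * norm d * \<epsilon> i) \<partial>lborel) = c i * V * (L * norm d * \<epsilon> i)"
      using integral_shell_sgn[of "\<lambda>_::'a. 1" 1 "\<epsilon> i"] \<epsilon>[of i] by (simp add: V_def c_def)
    finally show ?thesis
      using \<epsilon>(1)[of i] by (simp add: add_divide_distrib mult_ac)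
  qed
  have "(\<lambda>i. \<integral>p. (f p - f (p - d)) * cutoff (\<epsilon> i) p \<partial>lborel)
      \<longlonglongrightarrow> (\<integral>p. indicator ?B p * (f p - f (p - d)) \<partial>lborel)"
  proof (rule integral_dominated_convergence)
    show "integrable lborel (\<lambda>p. 2 * B * indicator ?B p)"
      by (rule integrable_lborel_bounded_support[where B = "2 * B" and r = 1])
         (use \<open>0 \<le> B\<close> in \<open>auto simp: indicator_def\<close>)
    show "AE p in lborel. norm ((f p - f (p - d)) * cutoff (\<epsilon> i) p) \<le> 2 * B * indicator ?B p" for i
    proof (rule AE_I2)
      fix p
      have "\<bar>f p - f (p - d)\<bar> \<le> 2 * B"
        using bound[of p] bound[of "p - d"] by linarith
      then have "\<bar>f p - f (p - d)\<bar> * cutoff (\<epsilon> i) p \<le> 2 * B * 1"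
        using cutoff_bounds[of "\<epsilon> i" p] \<open>0 \<le> B\<close> by (intro mult_mono) auto
      then show "norm ((f p - f (p - d)) * cutoff (\<epsilon> i) p) \<le> 2 * B * indicator ?B p"
        using \<epsilon>(1)[of i] cutoff_bounds[of "\<epsilon> i" p]
        by (cases "norm p < 1") (auto simp: abs_mult cutoff_eq_0)
    qed
    show "AE p in lborel. (\<lambda>i. (f p - f (p - d)) * cutoff (\<epsilon> i) p) \<longlonglongrightarrow> indicator ?B p * (f p - f (p - d))"
    proof (rule AE_I2)
      fix p
      have "(\<lambda>i. cutoff (\<epsilon> i) p) \<longlonglongrightarrow> indicator ?B p"
      proof (cases "norm p < 1")
        case True
        then have "\<forall>\<^sub>F i in sequentially. \<epsilon> i < 1 - norm p"
          using \<open>\<epsilon> \<longlonglongrightarrow> 0\<close> by (intro order_tendstoD) auto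
        then have "\<forall>\<^sub>F i in sequentially. cutoff (\<epsilon> i) p = 1"
          by (rule eventually_mono) (use \<epsilon> in \<open>auto intro!: cutoff_eq_1\<close>)
        then show ?thesis using True by (simp add: tendsto_eventually)
      qed (use \<epsilon> in \<open>simp add: cutoff_eq_0\<close>)
      from tendsto_mult_left[OF this, of "f p - f (p - d)"]
      show "(\<lambda>i. (f p - f (p - d)) * cutoff (\<epsilon> i) p) \<longlonglongrightarrow> indicator ?B p * (f p - f (p - d))"
        by (simp add: mult.commute)
    qed
  qed measurable
  moreover have "(\<lambda>i. c i / \<epsilon> i * A + L * norm d * c i * V) \<longlonglongrightarrow> real DIM('a) * A + L * norm d * 0 * V"
  proof (intro tendsto_intros)
    show "(\<lambda>i. c i / \<epsilon> i) \<longlonglongrightarrow> real DIM('a)"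
      unfolding c_def by (rule filterlim_compose[OF power_difference_quotient \<epsilon>_lim])
    show "c \<longlonglongrightarrow> 0"
      unfolding c_def[abs_def] using \<open>\<epsilon> \<longlonglongrightarrow> 0\<close> by (auto intro!: tendsto_eq_intros)
  qed
  ultimately have "(\<integral>p. indicator ?B p * (f p - f (p - d)) \<partial>lborel) \<le> real DIM('a) * A"
    using shell by (intro LIMSEQ_le) auto
  then have "(\<integral>p. indicator ?B p * (f p - f (p - d)) \<partial>lborel) / measure lborel ?B
      \<le> real DIM('a) * A / measure lborel ?B"
    by (rule divide_right_mono) simp
  then show ?thesis
    by (subst integral_uniform_measure[OF _ _ emeasure_unit_ball], simp, simp)
       (subst integral_uniform_sphere, simp, simp add: A_def)
qed

section \<open>Normalisation and mean of the uniform distribution on the sphere\<close>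

lemma sets_uniform_sphere [measurable_cong, simp]: "sets uniform_sphere = sets borel"
  by (simp add: uniform_sphere_def)

lemma prob_space_uniform_sphere: "prob_space (uniform_sphere :: 'a::euclidean_space measure)"
  unfolding uniform_sphere_def
  by (rule prob_space.prob_space_distr[OF prob_space_uniform_measure[OF emeasure_unit_ball]]) simp

lemma AE_uniform_sphere_norm_le: "AE e in (uniform_sphere :: 'a::euclidean_space measure). norm e \<le> 1"
  unfolding uniform_sphere_def by (subst AE_distr_iff) (auto simp: norm_sgn)

text \<open>For the constant function 1 the directional inequality has left side 0, so the mean of
  \<open>e \<bullet> c\<close> is nonnegative for every \<open>c\<close>. Taking
  \<open>c = d\<close> and \<open>c = - d\<close> gives both signs.\<close>

lemma uniform_sphere_mean_zero:
  fixes d :: "'a::euclidean_space"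
  shows "(\<integral>e. e \<bullet> d \<partial>uniform_sphere) = 0"
proof -
  have "0 \<le> real DIM('a) * (\<integral>e. e \<bullet> c \<partial>uniform_sphere)" for c :: 'a
    using uniform_sphere_directional_ge[of "\<lambda>_. 1" 1 0 c] by (simp add: lipschitz_on_def)
  then have "0 \<le> (\<integral>e. e \<bullet> c \<partial>uniform_sphere)" for c :: 'a
    by (simp add: zero_le_mult_iff)
  from this[of d] this[of "- d"] show ?thesis by simp
qed

section \<open>The smoothed saddle inequality\<close>

definition flip :: "'a::real_inner \<times> 'b::real_inner \<Rightarrow> 'a \<times> 'b" where
  "flip e = (fst e, - snd e)"

lemma flip_inner: "flip e \<bullet> w = e \<bullet> flip w"
  by (simp add: flip_def inner_prod_def)

lemma norm_flip [simp]: "norm (flip e) = norm e"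
  by (simp add: flip_def norm_prod_def)

lemma flip_measurable [measurable (raw)]:
  fixes f :: "'w \<Rightarrow> 'a::euclidean_space \<times> 'b::euclidean_space"
  assumes "f \<in> borel_measurable M"
  shows "(\<lambda>x. flip (f x)) \<in> borel_measurable M"
proof -
  have "flip \<in> borel_measurable (borel :: ('a \<times> 'b) measure)"
    unfolding flip_def[abs_def] by (intro borel_measurable_continuous_onI continuous_intros)
  with assms show ?thesis by measurable
qed

lemma add_mem_closed_neighbourhood:
  "w \<in> S \<Longrightarrow> norm d \<le> r \<Longrightarrow> w + d \<in> closed_neighbourhood r S"
  unfolding closed_neighbourhood_def by (rule UN_I[of w]) (simp_all add: dist_norm)

text \<open>The neighbourhood is the Minkowski sum of \<open>S\<close> and a closed ball, and sums
  of compact sets are compact.\<close>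

lemma compact_closed_neighbourhood:
  fixes S :: "'a::euclidean_space set"
  assumes "compact S" shows "compact (closed_neighbourhood r S)"
proof -
  have "closed_neighbourhood r S = {x + y |x y. x \<in> S \<and> y \<in> cball 0 r}"
  proof (intro equalityI subsetI)
    fix p assume "p \<in> closed_neighbourhood r S"
    then obtain x where "x \<in> S" "norm (p - x) \<le> r"
      by (auto simp: closed_neighbourhood_def dist_norm norm_minus_commute)
    then show "p \<in> {x + y |x y. x \<in> S \<and> y \<in> cball 0 r}"
      by (intro CollectI exI[of _ x] exI[of _ "p - x"]) simp
  qed (auto intro: add_mem_closed_neighbourhood)
  then show ?thesis by (simp only: compact_sums[OF assms compact_cball])
qed

lemma convex_on_transform:
  "convex_on S f \<Longrightarrow> (\<And>x. x \<in> S \<Longrightarrow> g x = f x) \<Longrightarrow> convex_on S g"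
  by (auto simp: convex_on_def convex_def)

text \<open>Transfers the convexity hypotheses to the extension of \<open>\<phi>\<close> by zero,
  which agrees with \<open>\<phi>\<close> on \<open>U\<close>.\<close>

lemma convex_concave_on_transform:
  "convex_concave_on U f \<Longrightarrow> (\<And>p. p \<in> U \<Longrightarrow> g p = f p) \<Longrightarrow> convex_concave_on U g"
  unfolding convex_concave_on_def concave_on_def
  by (safe; rule convex_on_transform) auto

text \<open>The directional inequality is applied to \<open>f\<close> in the x-direction and to
  \<open>- f\<close> in the y-direction. In the sum the values \<open>f p\<close> cancel, and what
  remains are ball averages around the corners \<open>(fst z, snd u)\<close> and
  \<open>(fst u, snd z)\<close>; undoing the smoothing costs \<open>\<tau> * M\<close> at each
  corner. The sign of the y-part combines the two directions into \<open>flip\<close>.\<close>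

lemma uniform_sphere_saddle_ge:
  fixes \<phi> :: "'a::euclidean_space \<times> 'b::euclidean_space \<Rightarrow> real"
  assumes U_def: "U = closed_neighbourhood \<tau> (X \<times> Y)"
    and [measurable]: "\<phi> \<in> borel_measurable borel"
    and bound: "\<And>p. \<bar>\<phi> p\<bar> \<le> K"
    and lip: "M-lipschitz_on U \<phi>"
    and cc: "convex_concave_on U \<phi>"
    and "0 < \<tau>" and z: "z \<in> X \<times> Y" and u: "u \<in> X \<times> Y"
  shows "\<phi> (fst z, snd u) - \<phi> (fst u, snd z) - 2 * \<tau> * M
    \<le> real DIM('a \<times> 'b) / \<tau> * (\<integral>e. \<phi> (z + \<tau> *\<^sub>R e) * (flip e \<bullet> (z - u)) \<partial>uniform_sphere)"
proof -
  interpret S: prob_space "uniform_sphere :: ('a \<times> 'b) measure"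
    by (rule prob_space_uniform_sphere)
  interpret B: prob_space "uniform_measure lborel (ball (0 :: 'a \<times> 'b) 1)"
    by (rule prob_space_uniform_measure[OF emeasure_unit_ball])
  define f where "f p = \<phi> (z + \<tau> *\<^sub>R p)" for p
  \<comment> \<open>Division by \<tau> compensates for the scaling inside \<open>f\<close>:
    subtracting \<open>dx\<close> from the argument moves the first component from \<open>z\<close>
    exactly to \<open>u\<close>, and \<open>dy\<close> does the same for the second.\<close>
  define dx where "dx = ((1 / \<tau>) *\<^sub>R (fst z - fst u), 0 :: 'b)"
  define dy where "dy = (0 :: 'a, (1 / \<tau>) *\<^sub>R (snd z - snd u))"
  have [measurable]: "f \<in> borel_measurable borel" unfolding f_def by measurable
  have "0 \<le> K" using bound[of z] by linarith
  have "0 \<le> M" using lip by (rule lipschitz_on_nonneg)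
  have U: "w + \<tau> *\<^sub>R p \<in> U" if "w \<in> X \<times> Y" "norm p \<le> 1" for w p
    unfolding U_def using that \<open>0 < \<tau>\<close> by (intro add_mem_closed_neighbourhood) (auto simp: mult_left_le)
  have z': "z \<in> X \<times> Y" "(fst u, snd z) \<in> X \<times> Y" "(fst z, snd u) \<in> X \<times> Y"
    using z u by (auto simp: mem_Times_iff)
  have fcx: "f (p - t *\<^sub>R dx)
      = \<phi> ((1 - t) *\<^sub>R (fst z + \<tau> *\<^sub>R fst p) + t *\<^sub>R (fst u + \<tau> *\<^sub>R fst p), snd z + \<tau> *\<^sub>R snd p)" for p t
    unfolding f_def using \<open>0 < \<tau>\<close>
    by (intro arg_cong[where f = \<phi>]) (auto simp: dx_def prod_eq_iff algebra_simps)
  have fcy: "f (p - t *\<^sub>R dy)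
      = \<phi> (fst z + \<tau> *\<^sub>R fst p, (1 - t) *\<^sub>R (snd z + \<tau> *\<^sub>R snd p) + t *\<^sub>R (snd u + \<tau> *\<^sub>R snd p))" for p t
    unfolding f_def using \<open>0 < \<tau>\<close>
    by (intro arg_cong[where f = \<phi>]) (auto simp: dy_def prod_eq_iff algebra_simps)
  have f_eq: "f p = \<phi> (fst z + \<tau> *\<^sub>R fst p, snd z + \<tau> *\<^sub>R snd p)" for p
    by (simp add: f_def plus_prod_def)
  have fx: "f (p - dx) = \<phi> (fst u + \<tau> *\<^sub>R fst p, snd z + \<tau> *\<^sub>R snd p)" for p
    using fcx[of p 1] by simp
  have fy: "f (p - dy) = \<phi> (fst z + \<tau> *\<^sub>R fst p, snd u + \<tau> *\<^sub>R snd p)" for p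
    using fcy[of p 1] by simp
  have mem: "(fst z + \<tau> *\<^sub>R fst p, snd z + \<tau> *\<^sub>R snd p) \<in> U"
      "(fst u + \<tau> *\<^sub>R fst p, snd z + \<tau> *\<^sub>R snd p) \<in> U"
      "(fst z + \<tau> *\<^sub>R fst p, snd u + \<tau> *\<^sub>R snd p) \<in> U" if "norm p \<le> 1" for p
    using U[OF z'(1) that] U[OF z'(2) that] U[OF z'(3) that] by (auto simp: plus_prod_def)
  have lipf: "(M * \<tau>)-lipschitz_on (cball 0 1) f"
  proof (rule lipschitz_onI)
    fix p q :: "'a \<times> 'b" assume "p \<in> cball 0 1" "q \<in> cball 0 1"
    then have "dist (f p) (f q) \<le> M * dist (z + \<tau> *\<^sub>R p) (z + \<tau> *\<^sub>R q)"
      unfolding f_def using z by (intro lipschitz_onD[OF lip] U) auto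
    then show "dist (f p) (f q) \<le> M * \<tau> * dist p q"
      using \<open>0 < \<tau>\<close> by (simp add: dist_norm flip: scaleR_diff_right)
  qed (use \<open>0 \<le> M\<close> \<open>0 < \<tau>\<close> in simp)
  have boundf: "\<bar>f p\<bar> \<le> K" for p unfolding f_def by (rule bound)
  have x: "(\<integral>p. f p - f (p - dx) \<partial>uniform_measure lborel (ball 0 1))
      \<le> real DIM('a \<times> 'b) * (\<integral>e. f e * (e \<bullet> dx) \<partial>uniform_sphere)"
  proof (rule uniform_sphere_directional_ge[OF _ boundf lipf])
    fix p :: "'a \<times> 'b" and t :: real assume p: "norm p \<le> 1" and t: "0 \<le> t" "t \<le> 1"
    have "convex_on {x. (x, snd z + \<tau> *\<^sub>R snd p) \<in> U} (\<lambda>x. \<phi> (x, snd z + \<tau> *\<^sub>R snd p))"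
      using cc unfolding convex_concave_on_def by blast
    from convex_onD[OF this t] mem[OF p]
    show "f (p - t *\<^sub>R dx) \<le> (1 - t) * f p + t * f (p - dx)"
      unfolding fx fcx f_eq[of p] by simp
  qed simp
  have y: "(\<integral>p. - f p - - f (p - dy) \<partial>uniform_measure lborel (ball 0 1))
      \<le> real DIM('a \<times> 'b) * (\<integral>e. - f e * (e \<bullet> dy) \<partial>uniform_sphere)"
  proof (rule uniform_sphere_directional_ge[where B = K and L = "M * \<tau>"])
    fix p :: "'a \<times> 'b" and t :: real assume p: "norm p \<le> 1" and t: "0 \<le> t" "t \<le> 1"
    have "convex_on {y. (fst z + \<tau> *\<^sub>R fst p, y) \<in> U} (\<lambda>y. - \<phi> (fst z + \<tau> *\<^sub>R fst p, y))"
      using cc unfolding convex_concave_on_def concave_on_def by blast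
    from convex_onD[OF this t] mem[OF p]
    show "- f (p - t *\<^sub>R dy) \<le> (1 - t) * - f p + t * - f (p - dy)"
      unfolding fy fcy f_eq[of p] by simp
  qed (use lipf boundf in simp_all)
  have intB: "integrable (uniform_measure lborel (ball 0 1)) (\<lambda>p. f (p - d))" for d
    by (rule B.integrable_const_bound[where B = K]) (use boundf in auto)
  have intS: "integrable uniform_sphere (\<lambda>e. f e * (e \<bullet> d))" for d
  proof (rule S.integrable_const_bound[where B = "K * norm d"])
    show "AE e in uniform_sphere. norm (f e * (e \<bullet> d)) \<le> K * norm d"
      using AE_uniform_sphere_norm_le
    proof eventually_elim
      case (elim e)
      have "\<bar>e \<bullet> d\<bar> \<le> 1 * norm d"
        by (rule order_trans[OF Cauchy_Schwarz_ineq2 mult_right_mono[OF elim]]) simp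
      then show ?case using boundf[of e] \<open>0 \<le> K\<close> by (simp add: abs_mult mult_mono)
    qed
  qed measurable
  have "\<phi> (fst z, snd u) - \<phi> (fst u, snd z) - 2 * \<tau> * M
      = (\<integral>p. \<phi> (fst z, snd u) - \<phi> (fst u, snd z) - 2 * \<tau> * M \<partial>uniform_measure lborel (ball (0 :: 'a \<times> 'b) 1))"
    using B.prob_space by simp
  also have "\<dots> \<le> (\<integral>p. f (p - dy) - f (p - dx) \<partial>uniform_measure lborel (ball 0 1))"
  proof (rule integral_mono_AE)
    have "AE p in uniform_measure lborel (ball (0 :: 'a \<times> 'b) 1). p \<in> ball 0 1"
      by (rule AE_uniform_measureI) auto
    then show "AE p in uniform_measure lborel (ball 0 1).
      \<phi> (fst z, snd u) - \<phi> (fst u, snd z) - 2 * \<tau> * M \<le> f (p - dy) - f (p - dx)"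
    proof eventually_elim
      case (elim p)
      then have p: "norm p \<le> 1" by simp
      have L: "\<bar>\<phi> (w + \<tau> *\<^sub>R p) - \<phi> w\<bar> \<le> M * \<tau>" if "w \<in> X \<times> Y" for w
      proof -
        have "w \<in> U" using U[OF that, of 0] by simp
        have "dist (\<phi> (w + \<tau> *\<^sub>R p)) (\<phi> w) \<le> M * dist (w + \<tau> *\<^sub>R p) w"
          by (rule lipschitz_onD[OF lip U[OF that p] \<open>w \<in> U\<close>])
        also have "\<dots> \<le> M * \<tau>"
          using \<open>0 < \<tau>\<close> \<open>0 \<le> M\<close> p by (intro mult_left_mono) (auto simp: dist_norm mult_left_le)
        finally show ?thesis by (simp add: dist_real_def)
      qed
      show ?case
        using L[OF z'(2)] L[OF z'(3)] unfolding fx fy by (simp add: plus_prod_def abs_le_iff algebra_simps)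
    qed
  qed (use intB in auto)
  also have "\<dots> = (\<integral>p. f p - f (p - dx) \<partial>uniform_measure lborel (ball 0 1))
      + (\<integral>p. - f p - - f (p - dy) \<partial>uniform_measure lborel (ball 0 1))"
    using intB[of 0] intB[of dx] intB[of dy] by simp
  also have "\<dots> \<le> real DIM('a \<times> 'b) * (\<integral>e. f e * (e \<bullet> dx) \<partial>uniform_sphere)
      + real DIM('a \<times> 'b) * (\<integral>e. - f e * (e \<bullet> dy) \<partial>uniform_sphere)"
    using x y by (rule add_mono)
  also have "\<dots> = real DIM('a \<times> 'b) * (\<integral>e. f e * (e \<bullet> dx) - f e * (e \<bullet> dy) \<partial>uniform_sphere)"
    using intS by (simp add: algebra_simps)
  also have "(\<integral>e. f e * (e \<bullet> dx) - f e * (e \<bullet> dy) \<partial>uniform_sphere)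
      = (\<integral>e. \<phi> (z + \<tau> *\<^sub>R e) * (flip e \<bullet> (z - u)) / \<tau> \<partial>uniform_sphere)"
    using \<open>0 < \<tau>\<close> by (intro Bochner_Integration.integral_cong)
      (auto simp: f_def dx_def dy_def flip_def inner_prod_def inner_diff_right field_simps)
  also have "real DIM('a \<times> 'b) * \<dots>
      = real DIM('a \<times> 'b) / \<tau> * (\<integral>e. \<phi> (z + \<tau> *\<^sub>R e) * (flip e \<bullet> (z - u)) \<partial>uniform_sphere)"
    by simp
  finally show ?thesis .
qed

subsection \<open>Independence, projections and the duality gap\<close>

text \<open>A joint law is determined by its values on rectangles, and there independence gives the
  product of the marginals.\<close>

lemma independent_rvs_distr:
  assumes "prob_space P" and "independent_rvs P A f B g"
  shows "distr P A f \<Otimes>\<^sub>M distr P B g = distr P (A \<Otimes>\<^sub>M B) (\<lambda>\<omega>. (f \<omega>, g \<omega>))"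
proof -
  interpret prob_space P by fact
  have [measurable]: "f \<in> measurable P A" "g \<in> measurable P B"
    and indep: "indep_set {f -` S \<inter> space P |S. S \<in> sets A} {g -` S \<inter> space P |S. S \<in> sets B}"
    using assms(2) unfolding independent_rvs_def by auto
  interpret f: prob_space "distr P A f" by (rule prob_space_distr) simp
  interpret g: prob_space "distr P B g" by (rule prob_space_distr) simp
  show ?thesis
  proof (rule pair_measure_eqI)
    fix S T assume "S \<in> sets (distr P A f)" "T \<in> sets (distr P B g)"
    then have [measurable]: "S \<in> sets A" "T \<in> sets B" by auto
    have "prob ((f -` S \<inter> space P) \<inter> (g -` T \<inter> space P)) = prob (f -` S \<inter> space P) * prob (g -` T \<inter> space P)"
      by (rule indep_setD[OF indep]) auto
    moreover have "(\<lambda>\<omega>. (f \<omega>, g \<omega>)) -` (S \<times> T) \<inter> space P = (f -` S \<inter> space P) \<inter> (g -` T \<inter> space P)"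
      by auto
    ultimately show "emeasure (distr P A f) S * emeasure (distr P B g) T
        = emeasure (distr P (A \<Otimes>\<^sub>M B) (\<lambda>\<omega>. (f \<omega>, g \<omega>))) (S \<times> T)"
      by (simp add: emeasure_distr emeasure_eq_measure ennreal_mult)
  qed (auto intro: f.sigma_finite_measure g.sigma_finite_measure simp: prob_space_imp_sigma_finite)
qed

text \<open>Plays the role of conditioning on \<open>g\<close>: Fubini for the product law
  integrates \<open>f\<close> out while \<open>g\<close> is frozen. Both integrals are pulled back
  to \<open>P\<close>, so later steps stay on the original probability space.\<close>

lemma independent_rvs_integral:
  fixes h :: "'a \<times> 'b \<Rightarrow> real"
  assumes P: "prob_space P" and indep: "independent_rvs P A f B g"
    and [measurable]: "h \<in> borel_measurable (A \<Otimes>\<^sub>M B)"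
    and int: "integrable P (\<lambda>\<omega>. h (f \<omega>, g \<omega>))"
  shows "(\<integral>\<omega>. h (f \<omega>, g \<omega>) \<partial>P) = (\<integral>\<omega>. (\<integral>\<omega>'. h (f \<omega>', g \<omega>) \<partial>P) \<partial>P)"
proof -
  interpret prob_space P by fact
  have [measurable]: "f \<in> measurable P A" "g \<in> measurable P B"
    using indep unfolding independent_rvs_def by auto
  interpret f: prob_space "distr P A f" by (rule prob_space_distr) simp
  interpret g: prob_space "distr P B g" by (rule prob_space_distr) simp
  interpret fg: pair_sigma_finite "distr P A f" "distr P B g" ..
  note eq = independent_rvs_distr[OF P indep]
  have int': "integrable (distr P A f \<Otimes>\<^sub>M distr P B g) (case_prod (\<lambda>x y. h (x, y)))"
    unfolding eq by (subst integrable_distr_eq) (simp_all add: int)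
  have "(\<integral>\<omega>. h (f \<omega>, g \<omega>) \<partial>P) = (\<integral>p. h p \<partial>(distr P A f \<Otimes>\<^sub>M distr P B g))"
    unfolding eq by (subst integral_distr) simp_all
  also have "\<dots> = (\<integral>y. (\<integral>x. h (x, y) \<partial>distr P A f) \<partial>distr P B g)"
    using fg.integral_snd[OF int'] by simp
  also have "\<dots> = (\<integral>y. (\<integral>\<omega>'. h (f \<omega>', y) \<partial>P) \<partial>distr P B g)"
    by (intro Bochner_Integration.integral_cong refl) (subst integral_distr, simp_all)
  also have "\<dots> = (\<integral>\<omega>. (\<integral>\<omega>'. h (f \<omega>', g \<omega>) \<partial>P) \<partial>P)"
    by (subst integral_distr) simp_all
  finally show ?thesis .
qed

section \<open>Projections, the duality gap and elementary inequalities\<close>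

text \<open>Completing the square turns the objective into half the squared distance from
  \<open>x - \<zeta>\<close> plus a constant.\<close>

lemma prox_eq_closest_point:
  fixes Z :: "'a::euclidean_space set"
  assumes "closed Z" "convex Z" "Z \<noteq> {}"
  shows "prox Z x \<zeta> = closest_point Z (x - \<zeta>)"
proof -
  let ?F = "\<lambda>y. bregman x y + \<zeta> \<bullet> y" and ?c = "closest_point Z (x - \<zeta>)"
  have F: "?F y = 1 / 2 * (dist (x - \<zeta>) y)\<^sup>2 + (\<zeta> \<bullet> x - 1 / 2 * (norm \<zeta>)\<^sup>2)" for y
    by (simp add: bregman_def dist_norm power2_norm_eq_inner algebra_simps inner_commute)
  have le: "?F a \<le> ?F b \<longleftrightarrow> dist (x - \<zeta>) a \<le> dist (x - \<zeta>) b" for a b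
    unfolding F by (simp add: power_mono_iff)
  have "?c \<in> Z" "\<And>y. y \<in> Z \<Longrightarrow> dist (x - \<zeta>) ?c \<le> dist (x - \<zeta>) y"
    using closest_point_exists[OF assms(1,3)] by auto
  then have "is_arg_min ?F (\<lambda>y. y \<in> Z) ?c"
    unfolding is_arg_min_linorder le by auto
  \<comment> \<open>\<open>prox\<close> is some minimiser picked by a choice operator. The existence
    of one makes the choice meaningful, and uniqueness of the nearest point then identifies
    it.\<close>
  then have "is_arg_min ?F (\<lambda>y. y \<in> Z) (prox Z x \<zeta>)"
    unfolding prox_def arg_min_def by (rule someI)
  then show ?thesis
    unfolding is_arg_min_linorder le using closest_point_unique[OF assms(2,1)] by blast
qed

text \<open>With the second component of \<open>u\<close> fixed, the bound passes to the infimum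
  over the first; the supremum over the second component comes afterwards.\<close>

lemma eps_sad_le:
  assumes "X \<noteq> {}" "Y \<noteq> {}"
    and "\<And>u. u \<in> X \<times> Y \<Longrightarrow> \<phi> (fst p, snd u) - \<phi> (fst u, snd p) \<le> C"
  shows "eps_sad X Y \<phi> p \<le> C"
proof -
  have "(SUP y'\<in>Y. \<phi> (fst p, y')) \<le> C + (INF x'\<in>X. \<phi> (x', snd p))"
  proof (rule cSUP_least[OF assms(2)])
    fix y assume "y \<in> Y"
    have "\<phi> (fst p, y) - C \<le> (INF x'\<in>X. \<phi> (x', snd p))"
    proof (rule cINF_greatest[OF assms(1)])
      fix x assume "x \<in> X"
      then show "\<phi> (fst p, y) - C \<le> \<phi> (x, snd p)"
        using assms(3)[of "(x, y)"] \<open>y \<in> Y\<close> by simp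
    qed
    then show "\<phi> (fst p, y) \<le> C + (INF x'\<in>X. \<phi> (x', snd p))" by simp
  qed
  then show ?thesis by (simp add: eps_sad_def)
qed

lemma sum_squared_le_3: "(a + b + c)\<^sup>2 \<le> 3 * a\<^sup>2 + 3 * b\<^sup>2 + 3 * (c::real)\<^sup>2"
  using zero_le_power2[of "a - b"] zero_le_power2[of "b - c"] zero_le_power2[of "a - c"]
  by (simp add: power2_eq_square algebra_simps)

lemma sum_squared_le_2: "(a + b)\<^sup>2 \<le> 2 * a\<^sup>2 + 2 * (b::real)\<^sup>2"
  using zero_le_power2[of "a - b"] by (simp add: power2_eq_square algebra_simps)

text \<open>Summing the recursion and adding the nonnegative last term on the right gives
  \<open>S \<le> m 0 + \<alpha> * S + N * c\<close> for the full sum \<open>S\<close>, which is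
  solved for \<open>S\<close>.\<close>

lemma sum_le_of_contraction:
  fixes m :: "nat \<Rightarrow> real"
  assumes "\<And>k. k < N \<Longrightarrow> m (Suc k) \<le> \<alpha> * m k + c" and "\<And>k. 0 \<le> m k" and "0 \<le> \<alpha>" "\<alpha> < 1"
  shows "(\<Sum>k\<le>N. m k) \<le> (m 0 + real N * c) / (1 - \<alpha>)"
proof -
  have "(\<Sum>k\<le>N. m k) = m 0 + (\<Sum>k<N. m (Suc k))"
    by (simp add: sum.atMost_shift)
  also have "\<dots> \<le> m 0 + (\<Sum>k<N. \<alpha> * m k + c)"
    using assms(1) by (intro add_left_mono sum_mono) auto
  also have "\<dots> = m 0 + \<alpha> * (\<Sum>k<N. m k) + real N * c"
    by (simp add: sum.distrib sum_distrib_left)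
  also have "\<dots> \<le> m 0 + \<alpha> * (\<Sum>k\<le>N. m k) + real N * c"
    using assms by (intro add_right_mono add_left_mono mult_left_mono sum_mono2) auto
  finally show ?thesis using \<open>\<alpha> < 1\<close> by (simp add: field_simps)
qed

subsection \<open>Residual feedback\<close>

text \<open>
  One oracle call: the base point, the direction and the stochastic noise.
\<close>
type_synonym ('a, 'b) oracle_call = "('a \<times> 'b) \<times> ('a \<times> 'b) \<times> real"

text \<open>
  Here \<open>\<phi>\<close> and \<open>\<delta>\<close> are bounded and measurable on the whole space; in the application they are
  extended by 0 outside the neighbourhood, which contains every query point.
\<close>
locale residual_feedback = prob_space P
  for P :: "'w measure" +
  fixes X :: "'a::euclidean_space set" and Y :: "'b::euclidean_space set"
    and \<phi> \<delta> :: "'a \<times> 'b \<Rightarrow> real"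
    and z e g :: "int \<Rightarrow> 'w \<Rightarrow> 'a \<times> 'b" and \<xi> :: "int \<Rightarrow> 'w \<Rightarrow> real"
    and z0 :: "'a \<times> 'b"
    and n M K \<Delta> \<sigma> \<tau> \<gamma> \<Omega> :: real and N :: nat
  assumes compact: "compact X" "compact Y" and convex: "convex X" "convex Y"
    and n: "n = real DIM('a \<times> 'b)"
    and \<Omega>: "\<Omega> = diameter (X \<times> Y)"
    and pos: "0 < M" "0 < \<tau>" "0 < \<gamma>"
    and convex_concave: "convex_concave_on (closed_neighbourhood \<tau> (X \<times> Y)) \<phi>"
    and lipschitz: "M-lipschitz_on (closed_neighbourhood \<tau> (X \<times> Y)) \<phi>"
    and \<phi>_measurable [measurable]: "\<phi> \<in> borel_measurable borel"
    and \<delta>_measurable [measurable]: "\<delta> \<in> borel_measurable borel"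
    and \<phi>_bound: "\<And>p. \<bar>\<phi> p\<bar> \<le> K"
    and \<delta>_bound: "\<And>p. \<bar>\<delta> p\<bar> \<le> \<Delta>"
    and \<xi>_square_integrable: "\<And>k. k \<in> {-1..int N} \<Longrightarrow> integrable P (\<lambda>\<omega>. (\<xi> k \<omega>)\<^sup>2)"
    and \<xi>_mean: "\<And>k. k \<in> {-1..int N} \<Longrightarrow> (\<integral>\<omega>. \<xi> k \<omega> \<partial>P) = 0"
    and \<xi>_variance: "\<And>k. k \<in> {-1..int N} \<Longrightarrow> (\<integral>\<omega>. (\<xi> k \<omega>)\<^sup>2 \<partial>P) \<le> \<sigma>\<^sup>2"
    and e_norm: "\<And>k \<omega>. k \<in> {-1..int N} \<Longrightarrow> \<omega> \<in> space P \<Longrightarrow> norm (e k \<omega>) = 1"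
    and e_uniform: "\<And>k. k \<in> {0..int N} \<Longrightarrow> distr P borel (e k) = uniform_sphere"
    and e_\<xi>_indep: "\<And>k. k \<in> {0..int N} \<Longrightarrow> independent_rvs P borel (e k) borel (\<xi> k)"
    and history_indep: "\<And>k. k \<in> {0..int N} \<Longrightarrow>
      independent_rvs P borel (\<lambda>\<omega>. (e k \<omega>, \<xi> k \<omega>))
        (Pi\<^sub>M {-1..<k} (\<lambda>_. borel)) (\<lambda>\<omega>. \<lambda>j\<in>{-1..<k}. (z j \<omega>, e j \<omega>, \<xi> j \<omega>))"
    and z_start: "\<And>\<omega>. \<omega> \<in> space P \<Longrightarrow> z (-1) \<omega> \<in> X \<times> Y" "z0 \<in> X \<times> Y"
      "\<And>\<omega>. \<omega> \<in> space P \<Longrightarrow> z 0 \<omega> = z0"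
    and g_eq: "\<And>k \<omega>. k \<in> {0..int N} \<Longrightarrow> \<omega> \<in> space P \<Longrightarrow>
      g k \<omega> = (n * ((\<phi> (z k \<omega> + \<tau> *\<^sub>R e k \<omega>) + \<xi> k \<omega> + \<delta> (z k \<omega> + \<tau> *\<^sub>R e k \<omega>))
        - (\<phi> (z (k - 1) \<omega> + \<tau> *\<^sub>R e (k - 1) \<omega>) + \<xi> (k - 1) \<omega>
          + \<delta> (z (k - 1) \<omega> + \<tau> *\<^sub>R e (k - 1) \<omega>))) / \<tau>) *\<^sub>R flip (e k \<omega>)"
    and z_step: "\<And>k \<omega>. k \<in> {0..int N} \<Longrightarrow> \<omega> \<in> space P \<Longrightarrow>
      z (k + 1) \<omega> = closest_point (X \<times> Y) (z k \<omega> - \<gamma> *\<^sub>R g k \<omega>)"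
begin

section \<open>The feasible set and its projection\<close>

abbreviation "Z \<equiv> X \<times> Y"

lemma Z_props: "compact Z" "closed Z" "convex Z" "Z \<noteq> {}" "bounded Z"
  using compact convex z_start(2) by (auto intro: compact_Times convex_Times compact_imp_closed compact_imp_bounded)

lemma proj_in: "closest_point Z p \<in> Z"
  using Z_props by (intro closest_point_in_set) auto

lemma proj_measurable [measurable]: "closest_point Z \<in> borel_measurable borel"
  using Z_props by (intro borel_measurable_continuous_onI continuous_on_closest_point) auto

lemma proj_dist: "u \<in> Z \<Longrightarrow> norm (closest_point Z p - u) \<le> norm (p - u)"
  using closest_point_lipschitz[of Z p u] Z_props by (simp add: closest_point_self dist_norm)

lemma diameter_bound: "p \<in> Z \<Longrightarrow> q \<in> Z \<Longrightarrow> norm (p - q) \<le> \<Omega>"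
  using diameter_bounded_bound[of Z p q] Z_props by (simp add: \<Omega> dist_norm)

lemma nonneg: "0 \<le> \<Omega>" "0 \<le> \<Delta>" "0 \<le> K" "0 < n"
  using diameter_bound[OF z_start(2) z_start(2)] \<delta>_bound[of z0] \<phi>_bound[of z0] by (auto simp: n add_pos_pos)

lemma z_in: "k \<in> {-1..int N + 1} \<Longrightarrow> \<omega> \<in> space P \<Longrightarrow> z k \<omega> \<in> Z"
  using z_start(1)[of \<omega>] z_start(2,3) z_step[of "k - 1" \<omega>] proj_in
  by (cases "k = -1"; cases "k = 0") auto

section \<open>Oracle calls, histories and measurability\<close>

definition query :: "('a, 'b) oracle_call \<Rightarrow> real" where
  "query a = \<phi> (fst a + \<tau> *\<^sub>R fst (snd a)) + snd (snd a) + \<delta> (fst a + \<tau> *\<^sub>R fst (snd a))"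

definition estimator :: "('a, 'b) oracle_call \<Rightarrow> ('a, 'b) oracle_call \<Rightarrow> 'a \<times> 'b" where
  "estimator a b = (n * (query a - query b) / \<tau>) *\<^sub>R flip (fst (snd a))"

definition traj :: "'w \<Rightarrow> int \<Rightarrow> ('a, 'b) oracle_call" where
  "traj \<omega> j = (z j \<omega>, e j \<omega>, \<xi> j \<omega>)"

lemma g_est: "k \<in> {0..int N} \<Longrightarrow> \<omega> \<in> space P \<Longrightarrow> g k \<omega> = estimator (traj \<omega> k) (traj \<omega> (k - 1))"
  by (simp add: g_eq estimator_def query_def traj_def)

lemma query_measurable [measurable]: "query \<in> borel_measurable borel"
proof -
  have [measurable]: "(\<lambda>a :: ('a, 'b) oracle_call. fst a + \<tau> *\<^sub>R fst (snd a)) \<in> borel_measurable borel"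
    "(\<lambda>a :: ('a, 'b) oracle_call. snd (snd a)) \<in> borel_measurable borel"
    by (auto intro!: borel_measurable_continuous_onI continuous_intros)
  show ?thesis unfolding query_def[abs_def] by measurable
qed

lemma estimator_measurable [measurable (raw)]:
  assumes [measurable]: "a \<in> borel_measurable A" "b \<in> borel_measurable A"
  shows "(\<lambda>x. estimator (a x) (b x)) \<in> borel_measurable A"
proof -
  have "(\<lambda>a :: ('a, 'b) oracle_call. fst (snd a)) \<in> borel_measurable borel"
    by (auto intro!: borel_measurable_continuous_onI continuous_intros)
  from measurable_compose[OF assms(1) this] show ?thesis
    unfolding estimator_def by measurable
qed

abbreviation "hist_space k \<equiv> Pi\<^sub>M {-1..<int k} (\<lambda>_. borel :: ('a, 'b) oracle_call measure)"

text \<open>The restriction makes the trajectory a point of \<open>hist_space k\<close>, in the form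
  in which \<open>history_indep\<close> speaks of the past of step \<open>k\<close>.\<close>

definition hist :: "nat \<Rightarrow> 'w \<Rightarrow> int \<Rightarrow> ('a, 'b) oracle_call" where
  "hist k \<omega> = restrict (traj \<omega>) {-1..<int k}"

text \<open>
  The iterates as functions of the oracle calls made before them. Step \<open>k\<close> reads the calls \<open>k\<close> and
  \<open>k - 1\<close>; the first call has index \<open>-1\<close>.
\<close>
fun iterate :: "nat \<Rightarrow> (int \<Rightarrow> ('a, 'b) oracle_call) \<Rightarrow> 'a \<times> 'b" where
  "iterate 0 h = z0"
| "iterate (Suc k) h = closest_point Z (fst (h (int k)) - \<gamma> *\<^sub>R estimator (h (int k)) (h (int k - 1)))"

text \<open>Longer histories are allowed because the dual descent evaluates \<open>iterate k\<close>
  on the history of step \<open>k + 1\<close>. The bound \<open>Suc N\<close> accounts for the point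
  produced by the last step.\<close>

lemma iterate_hist:
  assumes "k \<le> Suc N" "k \<le> m" "\<omega> \<in> space P" shows "iterate k (hist m \<omega>) = z (int k) \<omega>"
proof (cases k)
  case (Suc j)
  then have "hist m \<omega> (int j) = traj \<omega> (int j)" "hist m \<omega> (int j - 1) = traj \<omega> (int j - 1)"
    using assms by (simp_all add: hist_def)
  then show ?thesis
    using assms Suc z_step[of "int j" \<omega>] g_est[of "int j" \<omega>] by (simp add: add.commute traj_def)
qed (use assms z_start in simp)

lemma fst_borel:
  "fst \<in> borel_measurable (borel :: (('c::euclidean_space) \<times> ('d::second_countable_topology)) measure)"
  by (intro borel_measurable_continuous_onI continuous_intros)

text \<open>Every call stores its own base point, so one projection formula suffices and no
  induction over steps occurs. The free index set \<open>I\<close> serves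
  \<open>dual_measurable\<close>, whose induction stays in one fixed history space.\<close>

lemma iterate_measurable:
  assumes "{-1..<int k} \<subseteq> I" shows "iterate k \<in> borel_measurable (Pi\<^sub>M I (\<lambda>_. borel))"
proof (cases k)
  case (Suc j)
  then have "int j \<in> I" "int j - 1 \<in> I" using assms by auto
  then have c: "(\<lambda>h. h (int j)) \<in> borel_measurable (Pi\<^sub>M I (\<lambda>_. borel :: ('a, 'b) oracle_call measure))"
    "(\<lambda>h. h (int j - 1)) \<in> borel_measurable (Pi\<^sub>M I (\<lambda>_. borel :: ('a, 'b) oracle_call measure))"
    by (simp_all add: measurable_component_singleton)
  have "iterate k = (\<lambda>h. closest_point Z (fst (h (int j)) - \<gamma> *\<^sub>R estimator (h (int j)) (h (int j - 1))))"
    by (simp add: Suc fun_eq_iff)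
  then show ?thesis
    by (simp only:, intro measurable_compose[OF _ proj_measurable] borel_measurable_diff borel_measurable_scaleR
        borel_measurable_const measurable_compose[OF c(1) fst_borel] estimator_measurable c)
next
  case 0
  then have "iterate k = (\<lambda>_. z0)" by (simp add: fun_eq_iff)
  then show ?thesis by simp
qed

lemma hist_measurable [measurable]: "k \<le> N \<Longrightarrow> hist k \<in> measurable P (hist_space k)"
  using history_indep[of "int k"] by (simp add: independent_rvs_def hist_def[abs_def] traj_def[abs_def])

lemma z_measurable [measurable]: "k \<le> N \<Longrightarrow> z (int k) \<in> borel_measurable P"
  using measurable_compose[OF hist_measurable iterate_measurable[OF subset_refl], of k]
  by (subst measurable_cong[where g = "\<lambda>\<omega>. iterate k (hist k \<omega>)"]) (simp_all add: iterate_hist)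

text \<open>The call with index -1 precedes all steps; its measurability is read off the history of
  step 0, whose sole entry it is.\<close>

lemma traj_measurable:
  assumes "k \<in> {-1..int N}" shows "(\<lambda>\<omega>. traj \<omega> k) \<in> borel_measurable P"
proof (cases "k = -1")
  case True
  have "(\<lambda>\<omega>. hist 0 \<omega> (-1)) \<in> borel_measurable P"
    by (rule measurable_compose[OF hist_measurable measurable_component_singleton]) auto
  then show ?thesis using True by (simp add: hist_def)
next
  case False
  then have k: "k \<in> {0..int N}" using assms by auto
  have [measurable]: "e k \<in> borel_measurable P" "\<xi> k \<in> borel_measurable P"
    using e_\<xi>_indep[OF k] by (auto simp: independent_rvs_def)
  have [measurable]: "z k \<in> borel_measurable P"
    using z_measurable[of "nat k"] k by (simp add: nat_le_iff)
  show ?thesis unfolding traj_def by measurable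
qed

lemma e_measurable:
  assumes "k \<in> {-1..int N}" shows "e k \<in> borel_measurable P"
proof -
  have "(\<lambda>a :: ('a, 'b) oracle_call. fst (snd a)) \<in> borel_measurable borel"
    by (auto intro!: borel_measurable_continuous_onI continuous_intros)
  from measurable_compose[OF traj_measurable[OF assms] this] show ?thesis by (simp add: traj_def)
qed

lemma \<xi>_measurable:
  assumes "k \<in> {-1..int N}" shows "\<xi> k \<in> borel_measurable P"
proof -
  have "(\<lambda>a :: ('a, 'b) oracle_call. snd (snd a)) \<in> borel_measurable borel"
    by (auto intro!: borel_measurable_continuous_onI continuous_intros)
  from measurable_compose[OF traj_measurable[OF assms] this] show ?thesis by (simp add: traj_def)
qed

lemma g_measurable [measurable]:
  assumes "k \<in> {0..int N}" shows "g k \<in> borel_measurable P"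
proof -
  have [measurable]: "(\<lambda>\<omega>. traj \<omega> k) \<in> borel_measurable P" "(\<lambda>\<omega>. traj \<omega> (k - 1)) \<in> borel_measurable P"
    using assms by (auto intro!: traj_measurable)
  have "(\<lambda>\<omega>. estimator (traj \<omega> k) (traj \<omega> (k - 1))) \<in> borel_measurable P" by measurable
  then show ?thesis by (subst measurable_cong[OF g_est[OF assms]]) auto
qed

section \<open>The mean field of the estimator\<close>

text \<open>The deterministic noise stays inside the mean: it depends on the query point, hence on
  the direction, and may be correlated with it.\<close>

definition drift :: "'a \<times> 'b \<Rightarrow> 'a \<times> 'b" where
  "drift w = (n / \<tau>) *\<^sub>R (\<integral>e. (\<phi> (w + \<tau> *\<^sub>R e) + \<delta> (w + \<tau> *\<^sub>R e)) *\<^sub>R flip e \<partial>uniform_sphere)"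

lemma value_bound: "\<bar>\<phi> p + \<delta> p\<bar> \<le> K + \<Delta>"
  using \<phi>_bound[of p] \<delta>_bound[of p] by linarith

lemma drift_integrand_bound:
  assumes "norm d \<le> 1"
  shows "norm ((\<phi> (w + \<tau> *\<^sub>R d) + \<delta> (w + \<tau> *\<^sub>R d)) *\<^sub>R flip d) \<le> K + \<Delta>"
proof -
  have "\<bar>\<phi> (w + \<tau> *\<^sub>R d) + \<delta> (w + \<tau> *\<^sub>R d)\<bar> * norm d \<le> (K + \<Delta>) * 1"
    using assms value_bound nonneg by (intro mult_mono) auto
  then show ?thesis by simp
qed

lemma drift_integrable:
  "integrable uniform_sphere (\<lambda>e. (\<phi> (w + \<tau> *\<^sub>R e) + \<delta> (w + \<tau> *\<^sub>R e)) *\<^sub>R flip e)"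
proof -
  interpret S: prob_space "uniform_sphere :: ('a \<times> 'b) measure" by (rule prob_space_uniform_sphere)
  show ?thesis
  proof (rule S.integrable_const_bound[where B = "K + \<Delta>"])
    show "AE e in uniform_sphere. norm ((\<phi> (w + \<tau> *\<^sub>R e) + \<delta> (w + \<tau> *\<^sub>R e)) *\<^sub>R flip e) \<le> K + \<Delta>"
      using AE_uniform_sphere_norm_le
      by eventually_elim (rule drift_integrand_bound)
  qed measurable
qed

lemma drift_measurable [measurable]: "drift \<in> borel_measurable borel"
proof -
  interpret S: prob_space "uniform_sphere :: ('a \<times> 'b) measure" by (rule prob_space_uniform_sphere)
  show ?thesis unfolding drift_def[abs_def] by measurable
qed

lemma drift_inner:
  "drift w \<bullet> v = n / \<tau> * (\<integral>e. (\<phi> (w + \<tau> *\<^sub>R e) + \<delta> (w + \<tau> *\<^sub>R e)) * (flip e \<bullet> v) \<partial>uniform_sphere)"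
  unfolding drift_def using integral_inner_left[OF drift_integrable, of w v] by simp

lemma drift_norm: "norm (drift w) \<le> n / \<tau> * (K + \<Delta>)"
proof -
  interpret S: prob_space "uniform_sphere :: ('a \<times> 'b) measure" by (rule prob_space_uniform_sphere)
  let ?f = "\<lambda>e. (\<phi> (w + \<tau> *\<^sub>R e) + \<delta> (w + \<tau> *\<^sub>R e)) *\<^sub>R flip e"
  have "norm (\<integral>e. ?f e \<partial>uniform_sphere) \<le> (\<integral>e. norm (?f e) \<partial>uniform_sphere)"
    by (rule integral_norm_bound)
  also have "\<dots> \<le> (\<integral>e. K + \<Delta> \<partial>(uniform_sphere :: ('a \<times> 'b) measure))"
  proof (rule integral_mono_AE)
    show "AE e in uniform_sphere. norm (?f e) \<le> K + \<Delta>"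
      using AE_uniform_sphere_norm_le
      by eventually_elim (rule drift_integrand_bound)
  qed (use integrable_norm[OF drift_integrable] in auto)
  finally have "norm (\<integral>e. ?f e \<partial>uniform_sphere) \<le> K + \<Delta>" using S.prob_space by simp
  then show ?thesis
    unfolding drift_def using nonneg pos by (auto intro!: mult_left_mono simp del: times_divide_eq_left)
qed

text \<open>The part of \<open>drift\<close> due to \<open>\<phi>\<close> is handled by
  \<open>uniform_sphere_saddle_ge\<close>. In the part due to \<open>\<delta>\<close> the integrand
  is at most \<open>\<Delta> * \<Omega>\<close> in absolute value by Cauchy-Schwarz, which after the
  factor \<open>n / \<tau>\<close> gives the noise term.\<close>

lemma drift_saddle:
  assumes w: "w \<in> Z" and u: "u \<in> Z"
  shows "\<phi> (fst w, snd u) - \<phi> (fst u, snd w) \<le> 2 * \<tau> * M + \<Delta> * \<Omega> * n / \<tau> + drift w \<bullet> (w - u)"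
proof -
  interpret S: prob_space "uniform_sphere :: ('a \<times> 'b) measure" by (rule prob_space_uniform_sphere)
  have b: "AE e in uniform_sphere. norm (f (w + \<tau> *\<^sub>R e) * (flip e \<bullet> (w - u))) \<le> C * \<Omega>"
    if "\<And>p. \<bar>f p\<bar> \<le> C" for f :: "'a \<times> 'b \<Rightarrow> real" and C
    using AE_uniform_sphere_norm_le
  proof eventually_elim
    case (elim e)
    have "0 \<le> C" using that[of w] by linarith
    have "\<bar>flip e \<bullet> (w - u)\<bar> \<le> 1 * \<Omega>"
      using diameter_bound[OF w u] elim nonneg
      by (intro order_trans[OF Cauchy_Schwarz_ineq2 mult_mono]) auto
    then show ?case
      using that[of "w + \<tau> *\<^sub>R e"] \<open>0 \<le> C\<close> by (auto simp: abs_mult intro!: mult_mono)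
  qed
  have int: "integrable uniform_sphere (\<lambda>e. f (w + \<tau> *\<^sub>R e) * (flip e \<bullet> (w - u)))"
    if "\<And>p. \<bar>f p\<bar> \<le> C" "f \<in> borel_measurable borel" for f :: "'a \<times> 'b \<Rightarrow> real" and C
    by (rule S.integrable_const_bound[OF b[OF that(1)]]) (use that(2) in measurable)
  have "- (\<Delta> * \<Omega>) = (\<integral>e. - (\<Delta> * \<Omega>) \<partial>(uniform_sphere :: ('a \<times> 'b) measure))"
    using S.prob_space by simp
  also have "\<dots> \<le> (\<integral>e. \<delta> (w + \<tau> *\<^sub>R e) * (flip e \<bullet> (w - u)) \<partial>uniform_sphere)"
    using b[of \<delta> \<Delta>, OF \<delta>_bound]
    by (intro integral_mono_AE int[of \<delta> \<Delta>, OF \<delta>_bound]) (auto elim!: eventually_mono)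
  finally have "n / \<tau> * (- (\<Delta> * \<Omega>)) \<le> n / \<tau> * (\<integral>e. \<delta> (w + \<tau> *\<^sub>R e) * (flip e \<bullet> (w - u)) \<partial>uniform_sphere)"
    using nonneg pos by (intro mult_left_mono) auto
  moreover have "drift w \<bullet> (w - u) = n / \<tau> * (\<integral>e. \<phi> (w + \<tau> *\<^sub>R e) * (flip e \<bullet> (w - u)) \<partial>uniform_sphere)
      + n / \<tau> * (\<integral>e. \<delta> (w + \<tau> *\<^sub>R e) * (flip e \<bullet> (w - u)) \<partial>uniform_sphere)"
    unfolding drift_inner using int[of \<phi> K, OF \<phi>_bound] int[of \<delta> \<Delta>, OF \<delta>_bound]
    by (simp add: distrib_right distrib_left)
  moreover have "\<phi> (fst w, snd u) - \<phi> (fst u, snd w) - 2 * \<tau> * M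
      \<le> n / \<tau> * (\<integral>e. \<phi> (w + \<tau> *\<^sub>R e) * (flip e \<bullet> (w - u)) \<partial>uniform_sphere)"
    unfolding n by (rule uniform_sphere_saddle_ge[OF refl \<phi>_measurable \<phi>_bound lipschitz convex_concave pos(2) w u])
  ultimately show ?thesis by (simp add: mult_ac)
qed

section \<open>Regret of projected descent\<close>

text \<open>Squared distances to \<open>u\<close> telescope because the projection does not increase
  them. The statement is pathwise and leaves \<open>d\<close> free, so it serves both the estimators
  and their errors.\<close>

lemma projected_descent_regret:
  assumes "w 0 \<in> Z" and step: "\<And>k. k < m \<Longrightarrow> w (Suc k) = closest_point Z (w k - \<gamma> *\<^sub>R d k)"
    and u: "u \<in> Z"
  shows "(\<Sum>k<m. d k \<bullet> (w k - u)) \<le> \<Omega>\<^sup>2 / (2 * \<gamma>) + \<gamma> / 2 * (\<Sum>k<m. (norm (d k))\<^sup>2)"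
proof -
  \<comment> \<open>The final squared distance is what the induction telescopes against; it is
    dropped only after the induction.\<close>
  have "2 * \<gamma> * (\<Sum>k<m. d k \<bullet> (w k - u)) \<le> (norm (w 0 - u))\<^sup>2 - (norm (w m - u))\<^sup>2 + \<gamma>\<^sup>2 * (\<Sum>k<m. (norm (d k))\<^sup>2)"
    using step
  proof (induction m)
    case (Suc m)
    have "(norm (w (Suc m) - u))\<^sup>2 \<le> (norm (w m - \<gamma> *\<^sub>R d m - u))\<^sup>2"
      unfolding Suc.prems[OF lessI] by (intro power_mono proj_dist u) simp
    also have "\<dots> = (norm (w m - u))\<^sup>2 - 2 * \<gamma> * (d m \<bullet> (w m - u)) + \<gamma>\<^sup>2 * (norm (d m))\<^sup>2"
      unfolding power2_norm_eq_inner
      by (simp add: inner_diff_left inner_diff_right inner_commute power2_eq_square algebra_simps)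
    finally show ?case using Suc by (simp add: distrib_left)
  qed simp
  also have "\<dots> \<le> \<Omega>\<^sup>2 + \<gamma>\<^sup>2 * (\<Sum>k<m. (norm (d k))\<^sup>2)"
    using power_mono[OF diameter_bound[OF assms(1) u] norm_ge_zero, of 2] zero_le_power2[of "norm (w m - u)"]
    by linarith
  finally show ?thesis
    using pos by (simp add: field_simps power2_eq_square)
qed

section \<open>Means and integrability of the estimator\<close>

lemma mem_range: "k \<in> {0..int N} \<Longrightarrow> k \<in> {-1..int N}" by simp

lemma \<xi>_integrable:
  assumes "k \<in> {-1..int N}" shows "integrable P (\<xi> k)"
  using square_integrable_imp_integrable[OF \<xi>_measurable[OF assms] \<xi>_square_integrable[OF assms]] .

lemma expect_e:
  fixes F :: "'a \<times> 'b \<Rightarrow> real"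
  assumes "k \<in> {0..int N}" "F \<in> borel_measurable borel"
  shows "(\<integral>\<omega>. F (e k \<omega>) \<partial>P) = (\<integral>d. F d \<partial>uniform_sphere)"
  unfolding e_uniform[OF assms(1), symmetric]
  by (rule integral_distr[symmetric, OF e_measurable[OF mem_range[OF assms(1)]] assms(2)])

lemma integrable_times_direction:
  assumes k: "k \<in> {0..int N}" and F: "integrable P F"
  shows "integrable P (\<lambda>\<omega>. F \<omega> * (flip (e k \<omega>) \<bullet> v))"
proof (rule Bochner_Integration.integrable_bound[where f = "\<lambda>\<omega>. norm v * F \<omega>"])
  have [measurable]: "e k \<in> borel_measurable P" using k by (auto intro: e_measurable)
  show "(\<lambda>\<omega>. F \<omega> * (flip (e k \<omega>) \<bullet> v)) \<in> borel_measurable P"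
    using F by measurable
  show "AE \<omega> in P. norm (F \<omega> * (flip (e k \<omega>) \<bullet> v)) \<le> norm (norm v * F \<omega>)"
  proof (rule AE_I2)
    fix \<omega> assume "\<omega> \<in> space P"
    then have "\<bar>flip (e k \<omega>) \<bullet> v\<bar> \<le> norm v"
      using Cauchy_Schwarz_ineq2[of "flip (e k \<omega>)" v] e_norm[OF mem_range[OF k]] by simp
    then show "norm (F \<omega> * (flip (e k \<omega>) \<bullet> v)) \<le> norm (norm v * F \<omega>)"
      using mult_left_mono[of "\<bar>flip (e k \<omega>) \<bullet> v\<bar>" "norm v" "\<bar>F \<omega>\<bar>"]
      by (simp add: abs_mult mult.commute[of "norm v"])
  qed
qed (use F in simp)

lemma direction_mean:
  assumes k: "k \<in> {0..int N}" shows "(\<integral>\<omega>. flip (e k \<omega>) \<bullet> v \<partial>P) = 0"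
  using expect_e[OF k, of "\<lambda>d. flip d \<bullet> v"] by (simp add: flip_inner uniform_sphere_mean_zero)

text \<open>Independence allows the direction to be integrated out first with the noise frozen, and
  the direction has mean zero.\<close>

lemma noise_direction_mean:
  assumes k: "k \<in> {0..int N}" shows "(\<integral>\<omega>. \<xi> k \<omega> * (flip (e k \<omega>) \<bullet> v) \<partial>P) = 0"
  using independent_rvs_integral[OF prob_space_axioms e_\<xi>_indep[OF k], of "\<lambda>(d, s). s * (flip d \<bullet> v)"]
    integrable_times_direction[OF k \<xi>_integrable[OF mem_range[OF k]], of v] direction_mean[OF k, of v]
  by simp

text \<open>The base point \<open>w\<close> and the previous call \<open>b\<close> are frozen, as
  after conditioning on the history. The terms with the fresh noise and with \<open>query b\<close>
  multiply a direction of mean zero; what survives is \<open>drift\<close>.\<close>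

lemma estimator_mean:
  assumes k: "k \<in> {0..int N}"
  shows "has_bochner_integral P (\<lambda>\<omega>. estimator (w, e k \<omega>, \<xi> k \<omega>) b \<bullet> v) (drift w \<bullet> v)"
proof -
  have [measurable]: "e k \<in> borel_measurable P" using k by (auto intro: e_measurable)
  let ?F = "\<lambda>\<omega>. \<phi> (w + \<tau> *\<^sub>R e k \<omega>) + \<delta> (w + \<tau> *\<^sub>R e k \<omega>)" and ?d = "\<lambda>\<omega>. flip (e k \<omega>) \<bullet> v"
  have "integrable P ?F"
    by (rule integrable_const_bound[where B = "K + \<Delta>"]) (use value_bound in auto)
  then have 1: "integrable P (\<lambda>\<omega>. ?F \<omega> * ?d \<omega>)"
    by (rule integrable_times_direction[OF k])
  have 2: "integrable P (\<lambda>\<omega>. \<xi> k \<omega> * ?d \<omega>)"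
    by (rule integrable_times_direction[OF k \<xi>_integrable[OF mem_range[OF k]]])
  have 3: "integrable P ?d"
    using integrable_times_direction[OF k, of "\<lambda>_. 1"] by simp
  have "estimator (w, e k \<omega>, \<xi> k \<omega>) b \<bullet> v
      = n / \<tau> * (?F \<omega> * ?d \<omega> + \<xi> k \<omega> * ?d \<omega> - query b * ?d \<omega>)" for \<omega>
    by (simp add: estimator_def query_def algebra_simps add_divide_distrib diff_divide_distrib)
  moreover have "has_bochner_integral P (\<lambda>\<omega>. n / \<tau> * (?F \<omega> * ?d \<omega> + \<xi> k \<omega> * ?d \<omega> - query b * ?d \<omega>))
      (n / \<tau> * ((\<integral>\<omega>. ?F \<omega> * ?d \<omega> \<partial>P) + (\<integral>\<omega>. \<xi> k \<omega> * ?d \<omega> \<partial>P) - query b * (\<integral>\<omega>. ?d \<omega> \<partial>P)))"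
    by (intro has_bochner_integral_mult_right has_bochner_integral_diff has_bochner_integral_add
        has_bochner_integral_integrable 1 2 3)
  moreover have "(\<integral>\<omega>. ?F \<omega> * ?d \<omega> \<partial>P)
      = (\<integral>d. (\<phi> (w + \<tau> *\<^sub>R d) + \<delta> (w + \<tau> *\<^sub>R d)) * (flip d \<bullet> v) \<partial>uniform_sphere)"
    by (rule expect_e[OF k]) measurable
  ultimately show ?thesis
    by (simp only: noise_direction_mean[OF k] direction_mean[OF k] drift_inner) simp
qed

lemma g_norm:
  assumes "k \<in> {0..int N}" "\<omega> \<in> space P"
  shows "norm (g k \<omega>) = n / \<tau> * \<bar>query (traj \<omega> k) - query (traj \<omega> (k - 1))\<bar>"
  using g_est[OF assms] e_norm[of k \<omega>] assms nonneg pos by (simp add: estimator_def traj_def abs_mult)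

text \<open>A crude bound through \<open>K\<close>, whose purpose is finiteness; the quantitative
  estimate is \<open>g_norm_recursion\<close>.\<close>

lemma g_square_integrable:
  assumes k: "k \<in> {0..int N}" shows "integrable P (\<lambda>\<omega>. (norm (g k \<omega>))\<^sup>2)"
proof (rule Bochner_Integration.integrable_bound)
  let ?f = "\<lambda>\<omega>. (n / \<tau>)\<^sup>2 * (12 * (K + \<Delta>)\<^sup>2 + 3 * (\<xi> k \<omega>)\<^sup>2 + 3 * (\<xi> (k - 1) \<omega>)\<^sup>2)"
  show "integrable P ?f"
    using \<xi>_square_integrable[of k] \<xi>_square_integrable[of "k - 1"] k by simp
  show "(\<lambda>\<omega>. (norm (g k \<omega>))\<^sup>2) \<in> borel_measurable P" using k by measurable
  show "AE \<omega> in P. norm ((norm (g k \<omega>))\<^sup>2) \<le> norm (?f \<omega>)"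
  proof (rule AE_I2)
    fix \<omega> assume \<omega>: "\<omega> \<in> space P"
    \<comment> \<open>The part of the query difference free of stochastic noise. It is at most
      \<open>2 * (K + \<Delta>)\<close>, whence 12 = 3 * 4 after the three-term square
      inequality.\<close>
    define a where "a = query (traj \<omega> k) - query (traj \<omega> (k - 1)) - \<xi> k \<omega> + \<xi> (k - 1) \<omega>"
    have "\<bar>a\<bar> \<le> 2 * (K + \<Delta>)"
      using value_bound[of "z k \<omega> + \<tau> *\<^sub>R e k \<omega>"] value_bound[of "z (k - 1) \<omega> + \<tau> *\<^sub>R e (k - 1) \<omega>"]
      by (simp add: a_def query_def traj_def)
    then have "a\<^sup>2 \<le> (2 * (K + \<Delta>))\<^sup>2" using nonneg by (intro power2_le_iff_abs_le[THEN iffD2]) auto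
    then have "a\<^sup>2 \<le> 4 * (K + \<Delta>)\<^sup>2" unfolding power_mult_distrib by simp
    moreover have "(query (traj \<omega> k) - query (traj \<omega> (k - 1)))\<^sup>2 \<le> 3 * a\<^sup>2 + 3 * (\<xi> k \<omega>)\<^sup>2 + 3 * (\<xi> (k - 1) \<omega>)\<^sup>2"
      using sum_squared_le_3[of a "\<xi> k \<omega>" "- \<xi> (k - 1) \<omega>"] by (simp add: a_def)
    ultimately have "(query (traj \<omega> k) - query (traj \<omega> (k - 1)))\<^sup>2
        \<le> 12 * (K + \<Delta>)\<^sup>2 + 3 * (\<xi> k \<omega>)\<^sup>2 + 3 * (\<xi> (k - 1) \<omega>)\<^sup>2"
      by linarith
    then have "(norm (g k \<omega>))\<^sup>2 \<le> ?f \<omega>"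
      unfolding g_norm[OF k \<omega>] power_mult_distrib power2_abs by (rule mult_left_mono) simp
    then show "norm ((norm (g k \<omega>))\<^sup>2) \<le> norm (?f \<omega>)" by simp
  qed
qed

lemma g_inner_integrable:
  assumes k: "k \<in> {0..int N}" and [measurable]: "V \<in> borel_measurable P"
    and V: "\<And>\<omega>. \<omega> \<in> space P \<Longrightarrow> norm (V \<omega>) \<le> C"
  shows "integrable P (\<lambda>\<omega>. g k \<omega> \<bullet> V \<omega>)"
proof (rule Bochner_Integration.integrable_bound[where f = "\<lambda>\<omega>. C * norm (g k \<omega>)"])
  note [measurable] = g_measurable[OF k]
  have "integrable P (\<lambda>\<omega>. norm (g k \<omega>))"
    by (rule square_integrable_imp_integrable[OF _ g_square_integrable[OF k]]) measurable
  then show "integrable P (\<lambda>\<omega>. C * norm (g k \<omega>))" by simp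
  show "(\<lambda>\<omega>. g k \<omega> \<bullet> V \<omega>) \<in> borel_measurable P" by measurable
  show "AE \<omega> in P. norm (g k \<omega> \<bullet> V \<omega>) \<le> norm (C * norm (g k \<omega>))"
  proof (rule AE_I2)
    fix \<omega> assume "\<omega> \<in> space P"
    then have "norm (g k \<omega>) * norm (V \<omega>) \<le> norm (g k \<omega>) * C"
      by (intro mult_left_mono V) auto
    then show "norm (g k \<omega> \<bullet> V \<omega>) \<le> norm (C * norm (g k \<omega>))"
      using Cauchy_Schwarz_ineq2[of "g k \<omega>" "V \<omega>"] by (simp add: abs_mult) (smt (verit) mult.commute mult_right_mono norm_ge_zero)
  qed
qed

lemma drift_history_measurable: "k \<le> N \<Longrightarrow> (\<lambda>\<omega>. drift (z (int k) \<omega>)) \<in> borel_measurable P"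
  by (rule measurable_compose[OF z_measurable drift_measurable])

lemma drift_inner_integrable:
  assumes k: "k \<le> N" and [measurable]: "V \<in> borel_measurable P"
    and V: "\<And>\<omega>. \<omega> \<in> space P \<Longrightarrow> norm (V \<omega>) \<le> C"
  shows "integrable P (\<lambda>\<omega>. drift (z (int k) \<omega>) \<bullet> V \<omega>)"
proof (rule integrable_const_bound[where B = "n / \<tau> * (K + \<Delta>) * C"])
  note [measurable] = drift_history_measurable[OF k]
  show "(\<lambda>\<omega>. drift (z (int k) \<omega>) \<bullet> V \<omega>) \<in> borel_measurable P" by measurable
  show "AE \<omega> in P. norm (drift (z (int k) \<omega>) \<bullet> V \<omega>) \<le> n / \<tau> * (K + \<Delta>) * C"
  proof (rule AE_I2)
    fix \<omega> assume "\<omega> \<in> space P"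
    have "\<bar>drift (z (int k) \<omega>) \<bullet> V \<omega>\<bar> \<le> norm (drift (z (int k) \<omega>)) * norm (V \<omega>)"
      by (rule Cauchy_Schwarz_ineq2)
    also have "\<dots> \<le> n / \<tau> * (K + \<Delta>) * C"
      using nonneg pos \<open>\<omega> \<in> space P\<close> by (intro mult_mono drift_norm V) auto
    finally show "norm (drift (z (int k) \<omega>) \<bullet> V \<omega>) \<le> n / \<tau> * (K + \<Delta>) * C" by simp
  qed
qed

text \<open>The martingale difference property tested against bounded vectors \<open>W\<close> that
  depend on the past alone. With the history frozen, the inner integral over the fresh direction and
  noise vanishes by \<open>estimator_mean\<close>.\<close>

lemma estimator_martingale:
  assumes k: "k \<le> N" and [measurable]: "W \<in> borel_measurable (hist_space k)" and W: "\<And>h. norm (W h) \<le> C"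
  shows "(\<integral>\<omega>. (g (int k) \<omega> - drift (z (int k) \<omega>)) \<bullet> W (hist k \<omega>) \<partial>P) = 0"
proof -
  have k': "int k \<in> {0..int N}" using k by simp
  note [measurable] = g_measurable[OF k'] hist_measurable[OF k] z_measurable[OF k] iterate_measurable[OF subset_refl]
  have [measurable]: "(\<lambda>h. h (int k - 1)) \<in> borel_measurable (hist_space k)"
    by (rule measurable_component_singleton) simp
  \<comment> \<open>The estimator as a function of the fresh pair \<open>s\<close> and the history
    \<open>y\<close>. The previous call is the last entry of \<open>y\<close>, also for
    \<open>k = 0\<close>.\<close>
  let ?h = "\<lambda>(s, y). (estimator (iterate k y, s) (y (int k - 1)) - drift (iterate k y)) \<bullet> W y"
  have ind: "independent_rvs P borel (\<lambda>\<omega>. (e (int k) \<omega>, \<xi> (int k) \<omega>)) (hist_space k) (hist k)"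
    using history_indep[OF k'] by (simp add: hist_def[abs_def] traj_def[abs_def])
  have eq: "estimator (iterate k (hist k \<omega>), e (int k) \<omega>, \<xi> (int k) \<omega>) (hist k \<omega> (int k - 1)) = g (int k) \<omega>"
    "iterate k (hist k \<omega>) = z (int k) \<omega>" if "\<omega> \<in> space P" for \<omega>
    using that k iterate_hist[of k k \<omega>] g_est[OF k' that] by (auto simp: hist_def traj_def)
  have meas: "?h \<in> borel_measurable (borel \<Otimes>\<^sub>M hist_space k)" by measurable
  have int: "integrable P (\<lambda>\<omega>. (g (int k) \<omega> - drift (z (int k) \<omega>)) \<bullet> W (hist k \<omega>))"
    unfolding inner_diff_left
  proof (rule Bochner_Integration.integrable_diff)
    show "integrable P (\<lambda>\<omega>. g (int k) \<omega> \<bullet> W (hist k \<omega>))"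
      by (rule g_inner_integrable[OF k' _ W]) measurable
    show "integrable P (\<lambda>\<omega>. drift (z (int k) \<omega>) \<bullet> W (hist k \<omega>))"
      by (rule drift_inner_integrable[OF k _ W]) measurable
  qed
  have "(\<integral>\<omega>. (g (int k) \<omega> - drift (z (int k) \<omega>)) \<bullet> W (hist k \<omega>) \<partial>P)
      = (\<integral>\<omega>. ?h ((e (int k) \<omega>, \<xi> (int k) \<omega>), hist k \<omega>) \<partial>P)"
    using eq by (intro Bochner_Integration.integral_cong) auto
  also have "\<dots> = (\<integral>\<omega>. (\<integral>\<omega>'. ?h ((e (int k) \<omega>', \<xi> (int k) \<omega>'), hist k \<omega>) \<partial>P) \<partial>P)"
  proof (rule independent_rvs_integral[OF prob_space_axioms ind meas])
    show "integrable P (\<lambda>\<omega>. ?h ((e (int k) \<omega>, \<xi> (int k) \<omega>), hist k \<omega>))"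
      using int by (subst Bochner_Integration.integrable_cong[OF refl,
        where g = "\<lambda>\<omega>. (g (int k) \<omega> - drift (z (int k) \<omega>)) \<bullet> W (hist k \<omega>)"]) (use eq in auto)
  qed
  also have "\<dots> = (\<integral>\<omega>. 0 \<partial>P)"
  proof (rule Bochner_Integration.integral_cong[OF refl])
    fix \<omega> assume "\<omega> \<in> space P"
    show "(\<integral>\<omega>'. ?h ((e (int k) \<omega>', \<xi> (int k) \<omega>'), hist k \<omega>) \<partial>P) = 0"
      using estimator_mean[OF k', of "iterate k (hist k \<omega>)" "hist k \<omega> (int k - 1)" "W (hist k \<omega>)"] prob_space
      by (simp add: inner_diff_left has_bochner_integral_iff)
  qed
  finally show ?thesis by simp
qed

section \<open>Contraction of the second moments\<close>

lemma consecutive_directions_integrable: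
  assumes k: "k \<in> {0..int N}" shows "integrable P (\<lambda>\<omega>. e k \<omega> \<bullet> e (k - 1) \<omega>)"
proof -
  have [measurable]: "e k \<in> borel_measurable P" "e (k - 1) \<in> borel_measurable P"
    using k by (auto intro: e_measurable)
  show ?thesis
  proof (rule integrable_const_bound[where B = 1])
    show "AE \<omega> in P. norm (e k \<omega> \<bullet> e (k - 1) \<omega>) \<le> 1"
    proof (rule AE_I2)
      fix \<omega> assume "\<omega> \<in> space P"
      then show "norm (e k \<omega> \<bullet> e (k - 1) \<omega>) \<le> 1"
        using Cauchy_Schwarz_ineq2[of "e k \<omega>" "e (k - 1) \<omega>"] e_norm[of k] e_norm[of "k - 1"] k by simp
    qed
  qed measurable
qed

text \<open>The earlier direction belongs to the history and is frozen, while the fresh one has mean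
  zero. For \<open>k = 0\<close> the earlier direction is \<open>e (-1)\<close>, of which only the
  unit length is assumed.\<close>

lemma consecutive_directions_orthogonal:
  assumes k: "k \<in> {0..int N}" shows "(\<integral>\<omega>. e k \<omega> \<bullet> e (k - 1) \<omega> \<partial>P) = 0"
proof -
  let ?H = "Pi\<^sub>M {-1..<k} (\<lambda>_. borel :: ('a, 'b) oracle_call measure)"
  let ?h = "\<lambda>(s :: ('a \<times> 'b) \<times> real, y). fst s \<bullet> fst (snd (y (k - 1)))"
  have c: "(\<lambda>y. y (k - 1)) \<in> borel_measurable ?H"
    using k by (intro measurable_component_singleton) simp
  have "(\<lambda>a :: ('a, 'b) oracle_call. fst (snd a)) \<in> borel_measurable borel"
    by (auto intro!: borel_measurable_continuous_onI continuous_intros)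
  from measurable_compose[OF c this]
  have [measurable]: "(\<lambda>y. fst (snd (y (k - 1)))) \<in> borel_measurable ?H" .
  have "(fst :: ('a \<times> 'b) \<times> real \<Rightarrow> _) \<in> borel_measurable borel" by (rule fst_borel)
  then have meas: "?h \<in> borel_measurable (borel \<Otimes>\<^sub>M ?H)" by measurable
  have "(\<integral>\<omega>. e k \<omega> \<bullet> e (k - 1) \<omega> \<partial>P) = (\<integral>\<omega>. (\<integral>\<omega>'. e k \<omega>' \<bullet> e (k - 1) \<omega> \<partial>P) \<partial>P)"
    using independent_rvs_integral[OF prob_space_axioms history_indep[OF k] meas]
      consecutive_directions_integrable[OF k] k by simp
  also have "\<dots> = (\<integral>\<omega>. 0 \<partial>P)"
    using expect_e[OF k, of "\<lambda>d. d \<bullet> _"] by (simp add: uniform_sphere_mean_zero)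
  finally show ?thesis by simp
qed

text \<open>The query difference splits into the parts of \<open>\<phi>\<close>,
  \<open>\<xi>\<close> and \<open>\<delta>\<close>. Lipschitz continuity bounds the first by the
  displacement of the iterate, at most \<gamma> times the previous estimator norm, plus the change
  of direction. The coefficients 6 are 3 from this split times 2 from the square of a sum of two
  terms.\<close>

lemma g_norm_recursion:
  assumes k: "k \<in> {1..int N}" and \<omega>: "\<omega> \<in> space P"
  shows "(norm (g k \<omega>))\<^sup>2 \<le> 6 * \<gamma>\<^sup>2 * n\<^sup>2 * M\<^sup>2 / \<tau>\<^sup>2 * (norm (g (k - 1) \<omega>))\<^sup>2
    + 6 * n\<^sup>2 * M\<^sup>2 * (2 - 2 * (e k \<omega> \<bullet> e (k - 1) \<omega>))
    + n\<^sup>2 / \<tau>\<^sup>2 * (6 * (\<xi> k \<omega>)\<^sup>2 + 6 * (\<xi> (k - 1) \<omega>)\<^sup>2 + 12 * \<Delta>\<^sup>2)"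
proof -
  have k': "k \<in> {0..int N}" "k - 1 \<in> {0..int N}" using k by auto
  define U where "U = closed_neighbourhood \<tau> Z"
  define p where "p = z k \<omega> + \<tau> *\<^sub>R e k \<omega>"
  define q where "q = z (k - 1) \<omega> + \<tau> *\<^sub>R e (k - 1) \<omega>"
  define r where "r = norm (g (k - 1) \<omega>)"
  define s where "s = norm (e k \<omega> - e (k - 1) \<omega>)"
  have e1: "norm (e k \<omega>) = 1" "norm (e (k - 1) \<omega>) = 1"
    using e_norm[of k \<omega>] e_norm[of "k - 1" \<omega>] k \<omega> by auto
  have "z k \<omega> \<in> Z" "z (k - 1) \<omega> \<in> Z" using z_in[of _ \<omega>] k \<omega> by auto
  then have "p \<in> U" "q \<in> U"
    using e1 pos unfolding U_def p_def q_def by (simp_all add: add_mem_closed_neighbourhood)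
  \<comment> \<open>The exact value is kept instead of the bound 4: the inner product has mean zero,
    so the expected square is 2, which yields the constant 12 in front of
    \<open>n\<^sup>2 * M\<^sup>2\<close>.\<close>
  have s2: "s\<^sup>2 = 2 - 2 * (e k \<omega> \<bullet> e (k - 1) \<omega>)"
    using e1 by (simp add: s_def dot_norm_neg field_simps)
  have "z k \<omega> = closest_point Z (z (k - 1) \<omega> - \<gamma> *\<^sub>R g (k - 1) \<omega>)"
    using z_step[OF k'(2) \<omega>] by simp
  \<comment> \<open>The previous iterate lies in \<open>Z\<close>, so projecting does not increase
    the distance to it.\<close>
  then have "norm (z k \<omega> - z (k - 1) \<omega>) \<le> norm (z (k - 1) \<omega> - \<gamma> *\<^sub>R g (k - 1) \<omega> - z (k - 1) \<omega>)"
    by (simp only: proj_dist[OF \<open>z (k - 1) \<omega> \<in> Z\<close>])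
  then have zz: "norm (z k \<omega> - z (k - 1) \<omega>) \<le> \<gamma> * r"
    using pos by (simp add: r_def)
  have "p - q = (z k \<omega> - z (k - 1) \<omega>) + \<tau> *\<^sub>R (e k \<omega> - e (k - 1) \<omega>)"
    by (simp add: p_def q_def algebra_simps)
  then have "norm (p - q) \<le> norm (z k \<omega> - z (k - 1) \<omega>) + norm (\<tau> *\<^sub>R (e k \<omega> - e (k - 1) \<omega>))"
    by (metis norm_triangle_ineq)
  then have "norm (p - q) \<le> \<gamma> * r + \<tau> * s"
    using zz pos by (simp add: s_def)
  moreover have "\<bar>\<phi> p - \<phi> q\<bar> \<le> M * norm (p - q)"
    using lipschitz_onD[OF lipschitz] \<open>p \<in> U\<close> \<open>q \<in> U\<close> by (simp add: U_def dist_norm)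
  ultimately have "\<bar>\<phi> p - \<phi> q\<bar> \<le> M * (\<gamma> * r + \<tau> * s)"
    using pos by (meson less_imp_le mult_left_mono order_trans)
  then have "(\<phi> p - \<phi> q)\<^sup>2 \<le> (M * (\<gamma> * r + \<tau> * s))\<^sup>2"
    by (metis abs_ge_zero power2_abs power_mono)
  also have "\<dots> \<le> M\<^sup>2 * (2 * (\<gamma> * r)\<^sup>2 + 2 * (\<tau> * s)\<^sup>2)"
    unfolding power_mult_distrib[of M] by (intro mult_left_mono sum_squared_le_2) simp
  finally have 1: "(\<phi> p - \<phi> q)\<^sup>2 \<le> M\<^sup>2 * (2 * (\<gamma> * r)\<^sup>2 + 2 * (\<tau> * s)\<^sup>2)" .
  have 2: "(\<xi> k \<omega> - \<xi> (k - 1) \<omega>)\<^sup>2 \<le> 2 * (\<xi> k \<omega>)\<^sup>2 + 2 * (\<xi> (k - 1) \<omega>)\<^sup>2"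
    using sum_squared_le_2[of "\<xi> k \<omega>" "- \<xi> (k - 1) \<omega>"] by simp
  have "\<bar>\<delta> p - \<delta> q\<bar> \<le> 2 * \<Delta>" using \<delta>_bound[of p] \<delta>_bound[of q] by linarith
  then have "(\<delta> p - \<delta> q)\<^sup>2 \<le> (2 * \<Delta>)\<^sup>2" by (metis abs_ge_zero power2_abs power_mono)
  then have 3: "(\<delta> p - \<delta> q)\<^sup>2 \<le> 4 * \<Delta>\<^sup>2" by (simp add: power_mult_distrib)
  have "query (traj \<omega> k) - query (traj \<omega> (k - 1)) = (\<phi> p - \<phi> q) + (\<xi> k \<omega> - \<xi> (k - 1) \<omega>) + (\<delta> p - \<delta> q)"
    by (simp add: query_def traj_def p_def q_def)
  then have "(query (traj \<omega> k) - query (traj \<omega> (k - 1)))\<^sup>2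
      \<le> 3 * (\<phi> p - \<phi> q)\<^sup>2 + 3 * (\<xi> k \<omega> - \<xi> (k - 1) \<omega>)\<^sup>2 + 3 * (\<delta> p - \<delta> q)\<^sup>2"
    using sum_squared_le_3 by metis
  then have "(query (traj \<omega> k) - query (traj \<omega> (k - 1)))\<^sup>2
      \<le> 3 * (M\<^sup>2 * (2 * (\<gamma> * r)\<^sup>2 + 2 * (\<tau> * s)\<^sup>2)) + 6 * (\<xi> k \<omega>)\<^sup>2 + 6 * (\<xi> (k - 1) \<omega>)\<^sup>2 + 12 * \<Delta>\<^sup>2"
    using 1 2 3 by linarith
  then have "(norm (g k \<omega>))\<^sup>2 \<le> (n / \<tau>)\<^sup>2 *
      (3 * (M\<^sup>2 * (2 * (\<gamma> * r)\<^sup>2 + 2 * (\<tau> * s)\<^sup>2)) + 6 * (\<xi> k \<omega>)\<^sup>2 + 6 * (\<xi> (k - 1) \<omega>)\<^sup>2 + 12 * \<Delta>\<^sup>2)"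
    unfolding g_norm[OF k'(1) \<omega>] power_mult_distrib[of "n / \<tau>"] power2_abs
    by (intro mult_left_mono) auto
  also have "\<dots> = 6 * \<gamma>\<^sup>2 * n\<^sup>2 * M\<^sup>2 / \<tau>\<^sup>2 * r\<^sup>2 + 6 * n\<^sup>2 * M\<^sup>2 * s\<^sup>2
    + n\<^sup>2 / \<tau>\<^sup>2 * (6 * (\<xi> k \<omega>)\<^sup>2 + 6 * (\<xi> (k - 1) \<omega>)\<^sup>2 + 12 * \<Delta>\<^sup>2)"
    using pos by (simp add: power_mult_distrib power_divide field_simps)
  finally show ?thesis unfolding s2 r_def .
qed

lemma g_second_moment_recursion:
  assumes k: "k \<in> {1..int N}"
  shows "(\<integral>\<omega>. (norm (g k \<omega>))\<^sup>2 \<partial>P)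
    \<le> 6 * \<gamma>\<^sup>2 * n\<^sup>2 * M\<^sup>2 / \<tau>\<^sup>2 * (\<integral>\<omega>. (norm (g (k - 1) \<omega>))\<^sup>2 \<partial>P)
      + (12 * n\<^sup>2 * (\<sigma>\<^sup>2 + \<Delta>\<^sup>2) / \<tau>\<^sup>2 + 12 * n\<^sup>2 * M\<^sup>2)"
proof -
  let ?a = "6 * \<gamma>\<^sup>2 * n\<^sup>2 * M\<^sup>2 / \<tau>\<^sup>2"
  have k': "k \<in> {0..int N}" "k - 1 \<in> {0..int N}" "k \<in> {-1..int N}" "k - 1 \<in> {-1..int N}" using k by auto
  note int = g_square_integrable[OF k'(1)] g_square_integrable[OF k'(2)]
    \<xi>_square_integrable[OF k'(3)] \<xi>_square_integrable[OF k'(4)] consecutive_directions_integrable[OF k'(1)]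
  have "(\<integral>\<omega>. (norm (g k \<omega>))\<^sup>2 \<partial>P) \<le> (\<integral>\<omega>. ?a * (norm (g (k - 1) \<omega>))\<^sup>2
      + 6 * n\<^sup>2 * M\<^sup>2 * (2 - 2 * (e k \<omega> \<bullet> e (k - 1) \<omega>))
      + n\<^sup>2 / \<tau>\<^sup>2 * (6 * (\<xi> k \<omega>)\<^sup>2 + 6 * (\<xi> (k - 1) \<omega>)\<^sup>2 + 12 * \<Delta>\<^sup>2) \<partial>P)"
    by (intro integral_mono g_norm_recursion k) (use int in auto)
  also have "\<dots> = ?a * (\<integral>\<omega>. (norm (g (k - 1) \<omega>))\<^sup>2 \<partial>P)
      + 6 * n\<^sup>2 * M\<^sup>2 * (2 - 2 * (\<integral>\<omega>. e k \<omega> \<bullet> e (k - 1) \<omega> \<partial>P))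
      + n\<^sup>2 / \<tau>\<^sup>2 * (6 * (\<integral>\<omega>. (\<xi> k \<omega>)\<^sup>2 \<partial>P) + 6 * (\<integral>\<omega>. (\<xi> (k - 1) \<omega>)\<^sup>2 \<partial>P) + 12 * \<Delta>\<^sup>2)"
    using int prob_space by simp
  also have "\<dots> \<le> ?a * (\<integral>\<omega>. (norm (g (k - 1) \<omega>))\<^sup>2 \<partial>P)
      + 6 * n\<^sup>2 * M\<^sup>2 * (2 - 2 * 0) + n\<^sup>2 / \<tau>\<^sup>2 * (6 * \<sigma>\<^sup>2 + 6 * \<sigma>\<^sup>2 + 12 * \<Delta>\<^sup>2)"
    unfolding consecutive_directions_orthogonal[OF k'(1)]
    by (intro add_mono mult_left_mono order_refl \<xi>_variance k') auto
  also have "\<dots> = ?a * (\<integral>\<omega>. (norm (g (k - 1) \<omega>))\<^sup>2 \<partial>P)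
      + (12 * n\<^sup>2 * (\<sigma>\<^sup>2 + \<Delta>\<^sup>2) / \<tau>\<^sup>2 + 12 * n\<^sup>2 * M\<^sup>2)"
    by (simp add: field_simps)
  finally show ?thesis .
qed

text \<open>
  The auxiliary descent on the errors of the estimator, whose regret absorbs a comparison point
  that depends on the noise.
\<close>
fun dual :: "nat \<Rightarrow> (int \<Rightarrow> ('a, 'b) oracle_call) \<Rightarrow> 'a \<times> 'b" where
  "dual 0 h = z0"
| "dual (Suc k) h = closest_point Z (dual k h - \<gamma> *\<^sub>R (drift (iterate k h) - estimator (h (int k)) (h (int k - 1))))"

lemma dual_in: "dual k h \<in> Z"
  using z_start(2) proj_in by (cases k) auto

lemma dual_measurable:
  assumes "{-1..<int k} \<subseteq> I" shows "dual k \<in> borel_measurable (Pi\<^sub>M I (\<lambda>_. borel))"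
  using assms
proof (induction k)
  case (Suc k)
  then have sub: "{-1..<int k} \<subseteq> I" "int k \<in> I" "int k - 1 \<in> I" by auto
  then have c: "(\<lambda>h. h (int k)) \<in> borel_measurable (Pi\<^sub>M I (\<lambda>_. borel :: ('a, 'b) oracle_call measure))"
    "(\<lambda>h. h (int k - 1)) \<in> borel_measurable (Pi\<^sub>M I (\<lambda>_. borel :: ('a, 'b) oracle_call measure))"
    by (simp_all add: measurable_component_singleton)
  have "dual (Suc k) = (\<lambda>h. closest_point Z (dual k h - \<gamma> *\<^sub>R (drift (iterate k h) - estimator (h (int k)) (h (int k - 1)))))"
    by (simp add: fun_eq_iff)
  then show ?case
    by (simp only:, intro measurable_compose[OF _ proj_measurable] borel_measurable_diff borel_measurable_scaleR
        borel_measurable_const Suc.IH sub(1) measurable_compose[OF iterate_measurable[OF sub(1)] drift_measurable]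
        estimator_measurable c)
next
  case 0
  have "dual 0 = (\<lambda>_. z0)" by (simp add: fun_eq_iff)
  then show ?case by simp
qed

definition dual_seq :: "nat \<Rightarrow> 'w \<Rightarrow> 'a \<times> 'b" where
  "dual_seq k \<omega> = dual k (hist k \<omega>)"

lemma dual_seq_Suc:
  assumes "k \<le> N" "\<omega> \<in> space P"
  shows "dual_seq (Suc k) \<omega> = closest_point Z (dual_seq k \<omega> - \<gamma> *\<^sub>R (drift (z (int k) \<omega>) - g (int k) \<omega>))"
proof -
  \<comment> \<open>The point with index \<open>j\<close> reads only calls with index below
    \<open>j\<close>, so a longer history gives the same value. This aligns the histories of steps
    \<open>k\<close> and \<open>k + 1\<close>.\<close>
  have restrict: "dual j (hist m \<omega>) = dual j (hist j \<omega>)" if "j \<le> m" "j \<le> Suc N" for j m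
    using that
  proof (induction j arbitrary: m)
    case (Suc j)
    have "dual j (hist m \<omega>) = dual j (hist (Suc j) \<omega>)"
      using Suc.IH[of m] Suc.IH[of "Suc j"] Suc.prems by simp
    moreover have "iterate j (hist m \<omega>) = iterate j (hist (Suc j) \<omega>)"
      using Suc.prems assms(2) by (simp add: iterate_hist)
    moreover have "hist m \<omega> i = hist (Suc j) \<omega> i" if "i \<in> {int j, int j - 1}" for i
      using Suc.prems that by (auto simp: hist_def)
    ultimately show ?case by simp
  qed simp
  have "dual_seq (Suc k) \<omega> = closest_point Z (dual k (hist (Suc k) \<omega>)
      - \<gamma> *\<^sub>R (drift (iterate k (hist (Suc k) \<omega>)) - estimator (traj \<omega> (int k)) (traj \<omega> (int k - 1))))"
    by (simp add: dual_seq_def hist_def)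
  then show ?thesis
    using restrict[of k "Suc k"] assms iterate_hist[of k "Suc k" \<omega>] g_est[of "int k" \<omega>] by (simp add: dual_seq_def)
qed

section \<open>From the duality gap to the regret and its expectation\<close>

text \<open>Jensen's inequality in each variable, with the other variable taken from
  \<open>u\<close>, reduces the gap at the average to an average of gaps at the iterates, to which
  \<open>drift_saddle\<close> applies.\<close>

lemma gap_le_regret:
  assumes u: "u \<in> Z" and \<omega>: "\<omega> \<in> space P"
  defines "zbar \<equiv> (1 / (real N + 1)) *\<^sub>R (\<Sum>k\<le>N. z (int k) \<omega>)"
  shows "\<phi> (fst zbar, snd u) - \<phi> (fst u, snd zbar)
    \<le> 2 * \<tau> * M + \<Delta> * \<Omega> * n / \<tau> + 1 / (real N + 1) * (\<Sum>k\<le>N. drift (z (int k) \<omega>) \<bullet> (z (int k) \<omega> - u))"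
proof -
  let ?w = "\<lambda>k. z (int k) \<omega>" and ?c = "1 / (real N + 1)" and ?U = "closed_neighbourhood \<tau> Z"
  have zk: "?w k \<in> Z" if "k \<le> N" for k using z_in[of "int k" \<omega>] that \<omega> by simp
  have U: "p \<in> ?U" if "p \<in> Z" for p
    using add_mem_closed_neighbourhood[OF that, of 0 \<tau>] pos by simp
  have mix: "(fst (?w k), snd u) \<in> Z" "(fst u, snd (?w k)) \<in> Z" if "k \<le> N" for k
    using zk[OF that] u by (auto simp: mem_Times_iff)
  have c: "(\<Sum>k\<le>N. ?c) = 1" "\<And>k. 0 \<le> ?c" by (auto simp: field_simps)
  have fstz: "fst zbar = (\<Sum>k\<le>N. ?c *\<^sub>R fst (?w k))" and sndz: "snd zbar = (\<Sum>k\<le>N. ?c *\<^sub>R snd (?w k))"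
    by (simp_all add: zbar_def fst_sum snd_sum scaleR_sum_right)
  have cx: "convex_on {x. (x, snd u) \<in> ?U} (\<lambda>x. \<phi> (x, snd u))"
    and cy: "convex_on {y. (fst u, y) \<in> ?U} (\<lambda>y. - \<phi> (fst u, y))"
    using convex_concave unfolding convex_concave_on_def concave_on_def by blast+
  have "\<phi> (fst zbar, snd u) \<le> (\<Sum>k\<le>N. ?c * \<phi> (fst (?w k), snd u))"
    unfolding fstz using mix
    by (intro convex_on_sum[OF _ _ cx]) (auto simp: c simp del: of_nat_add mem_Sigma_iff intro: U)
  moreover have "- \<phi> (fst u, snd zbar) \<le> (\<Sum>k\<le>N. ?c * - \<phi> (fst u, snd (?w k)))"
    unfolding sndz using mix
    by (intro convex_on_sum[OF _ _ cy]) (auto simp: c simp del: of_nat_add mem_Sigma_iff intro: U)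
  ultimately have "\<phi> (fst zbar, snd u) - \<phi> (fst u, snd zbar)
      \<le> ?c * (\<Sum>k\<le>N. \<phi> (fst (?w k), snd u) - \<phi> (fst u, snd (?w k)))"
    by (simp add: sum_subtractf sum_negf flip: sum_distrib_left sum_divide_distrib) (simp add: diff_divide_distrib)
  also have "\<dots> \<le> ?c * (\<Sum>k\<le>N. 2 * \<tau> * M + \<Delta> * \<Omega> * n / \<tau> + drift (?w k) \<bullet> (?w k - u))"
    by (intro mult_left_mono sum_mono drift_saddle zk u) auto
  also have "\<dots> = 2 * \<tau> * M + \<Delta> * \<Omega> * n / \<tau> + ?c * (\<Sum>k\<le>N. drift (?w k) \<bullet> (?w k - u))"
  proof -
    have "?c * (\<Sum>k\<le>N. C + f k) = C + ?c * (\<Sum>k\<le>N. f k)" for C :: real and f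
      by (simp add: sum.distrib field_simps)
    then show ?thesis .
  qed
  finally show ?thesis .
qed

text \<open>Each term splits into the regret of the iterates, the regret of the dual descent fed
  with \<open>drift - g\<close>, and a remainder without \<open>u\<close>. Each regret contributes
  \<open>\<Omega>\<^sup>2 / (2 * \<gamma>)\<close>. The right side is independent of
  \<open>u\<close>, so the bound holds for all comparison points at once.\<close>

lemma linear_regret_le:
  assumes u: "u \<in> Z" and \<omega>: "\<omega> \<in> space P"
  shows "(\<Sum>k\<le>N. drift (z (int k) \<omega>) \<bullet> (z (int k) \<omega> - u))
    \<le> \<Omega>\<^sup>2 / \<gamma> + \<gamma> / 2 * (\<Sum>k\<le>N. (norm (g (int k) \<omega>))\<^sup>2 + (norm (g (int k) \<omega> - drift (z (int k) \<omega>)))\<^sup>2)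
      - (\<Sum>k\<le>N. (g (int k) \<omega> - drift (z (int k) \<omega>)) \<bullet> (z (int k) \<omega> - dual_seq k \<omega>))"
proof -
  let ?w = "\<lambda>k. z (int k) \<omega>" and ?g = "\<lambda>k. g (int k) \<omega>"
  have "(\<Sum>k<Suc N. ?g k \<bullet> (?w k - u)) \<le> \<Omega>\<^sup>2 / (2 * \<gamma>) + \<gamma> / 2 * (\<Sum>k<Suc N. (norm (?g k))\<^sup>2)"
    using z_start \<omega> z_step[of "int _" \<omega>]
    by (intro projected_descent_regret u) (simp_all add: add.commute del: mem_Sigma_iff)
  moreover have "(\<Sum>k<Suc N. (drift (?w k) - ?g k) \<bullet> (dual_seq k \<omega> - u))
      \<le> \<Omega>\<^sup>2 / (2 * \<gamma>) + \<gamma> / 2 * (\<Sum>k<Suc N. (norm (drift (?w k) - ?g k))\<^sup>2)"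
    using z_start dual_seq_Suc \<omega>
    by (intro projected_descent_regret u) (auto simp: dual_seq_def[of 0] simp del: mem_Sigma_iff)
  moreover have "(\<Sum>k\<le>N. drift (?w k) \<bullet> (?w k - u)) = (\<Sum>k\<le>N. ?g k \<bullet> (?w k - u))
      + (\<Sum>k\<le>N. (drift (?w k) - ?g k) \<bullet> (dual_seq k \<omega> - u)) - (\<Sum>k\<le>N. (?g k - drift (?w k)) \<bullet> (?w k - dual_seq k \<omega>))"
    unfolding sum.distrib[symmetric] sum_subtractf[symmetric]
    by (rule sum.cong) (auto simp: inner_diff_left inner_diff_right)
  ultimately show ?thesis
    by (simp add: lessThan_Suc_atMost sum.distrib distrib_left norm_minus_commute)
qed

lemma dual_seq_measurable: "k \<le> N \<Longrightarrow> dual_seq k \<in> borel_measurable P"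
  unfolding dual_seq_def[abs_def]
  by (rule measurable_compose[OF hist_measurable dual_measurable[OF subset_refl]])

lemma drift_square_integrable: "k \<le> N \<Longrightarrow> integrable P (\<lambda>\<omega>. (norm (drift (z (int k) \<omega>)))\<^sup>2)"
proof (rule integrable_const_bound[where B = "(n / \<tau> * (K + \<Delta>))\<^sup>2"])
  assume "k \<le> N"
  note [measurable] = drift_history_measurable[OF this]
  show "(\<lambda>\<omega>. (norm (drift (z (int k) \<omega>)))\<^sup>2) \<in> borel_measurable P" by measurable
  show "AE \<omega> in P. norm ((norm (drift (z (int k) \<omega>)))\<^sup>2) \<le> (n / \<tau> * (K + \<Delta>))\<^sup>2"
    using drift_norm by (intro AE_I2) (simp add: power_mono del: times_divide_eq_left)
qed

text \<open>A variance is at most a second moment: testing the martingale property against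
  \<open>drift\<close> itself shows that \<open>g \<bullet> drift\<close> and the squared norm of
  \<open>drift\<close> have the same mean.\<close>

lemma centered_estimator:
  assumes k: "k \<le> N"
  shows "integrable P (\<lambda>\<omega>. (norm (g (int k) \<omega> - drift (z (int k) \<omega>)))\<^sup>2)"
    and "(\<integral>\<omega>. (norm (g (int k) \<omega> - drift (z (int k) \<omega>)))\<^sup>2 \<partial>P) \<le> (\<integral>\<omega>. (norm (g (int k) \<omega>))\<^sup>2 \<partial>P)"
proof -
  have k': "int k \<in> {0..int N}" using k by simp
  let ?g = "g (int k)" and ?drift = "\<lambda>\<omega>. drift (z (int k) \<omega>)"
  have eq: "(norm (?g \<omega> - ?drift \<omega>))\<^sup>2 = (norm (?g \<omega>))\<^sup>2 - 2 * (?g \<omega> \<bullet> ?drift \<omega>) + (norm (?drift \<omega>))\<^sup>2" for \<omega>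
    by (simp add: power2_norm_eq_inner inner_diff_left inner_diff_right inner_commute)
  have gG: "integrable P (\<lambda>\<omega>. ?g \<omega> \<bullet> ?drift \<omega>)"
    by (rule g_inner_integrable[OF k' drift_history_measurable[OF k] drift_norm])
  note int = g_square_integrable[OF k'] gG drift_square_integrable[OF k]
  show "integrable P (\<lambda>\<omega>. (norm (?g \<omega> - ?drift \<omega>))\<^sup>2)"
    unfolding eq using int by simp
  have "(\<integral>\<omega>. (?g \<omega> - ?drift \<omega>) \<bullet> drift (iterate k (hist k \<omega>)) \<partial>P) = 0"
    by (rule estimator_martingale[OF k measurable_compose[OF iterate_measurable[OF subset_refl] drift_measurable] drift_norm])
  also have "(\<integral>\<omega>. (?g \<omega> - ?drift \<omega>) \<bullet> drift (iterate k (hist k \<omega>)) \<partial>P) = (\<integral>\<omega>. ?g \<omega> \<bullet> ?drift \<omega> - (norm (?drift \<omega>))\<^sup>2 \<partial>P)"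
    using k by (intro Bochner_Integration.integral_cong)
      (auto simp: iterate_hist inner_diff_left power2_norm_eq_inner)
  finally have "(\<integral>\<omega>. ?g \<omega> \<bullet> ?drift \<omega> \<partial>P) = (\<integral>\<omega>. (norm (?drift \<omega>))\<^sup>2 \<partial>P)"
    using int by simp
  moreover have "0 \<le> (\<integral>\<omega>. (norm (?drift \<omega>))\<^sup>2 \<partial>P)" by simp
  ultimately show "(\<integral>\<omega>. (norm (?g \<omega> - ?drift \<omega>))\<^sup>2 \<partial>P) \<le> (\<integral>\<omega>. (norm (?g \<omega>))\<^sup>2 \<partial>P)"
    unfolding eq using int by simp
qed

text \<open>Both the iterate and the dual point are functions of the history and lie in
  \<open>Z\<close>, so their difference is an admissible test vector bounded by
  \<open>\<Omega>\<close>.\<close>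

lemma dual_term:
  assumes k: "k \<le> N"
  shows "integrable P (\<lambda>\<omega>. (g (int k) \<omega> - drift (z (int k) \<omega>)) \<bullet> (z (int k) \<omega> - dual_seq k \<omega>))"
    and "(\<integral>\<omega>. (g (int k) \<omega> - drift (z (int k) \<omega>)) \<bullet> (z (int k) \<omega> - dual_seq k \<omega>) \<partial>P) = 0"
proof -
  have k': "int k \<in> {0..int N}" using k by simp
  let ?V = "\<lambda>\<omega>. z (int k) \<omega> - dual_seq k \<omega>" and ?drift = "\<lambda>\<omega>. drift (z (int k) \<omega>)"
  note meas [measurable] = z_measurable[OF k] dual_seq_measurable[OF k] drift_history_measurable[OF k]
  have V: "norm (?V \<omega>) \<le> \<Omega>" if "\<omega> \<in> space P" for \<omega>
    using diameter_bound[OF _ dual_in] z_in[of "int k" \<omega>] k that by (simp add: dual_seq_def)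
  have "integrable P (\<lambda>\<omega>. ?drift \<omega> \<bullet> ?V \<omega>)"
    by (rule drift_inner_integrable[OF k _ V]) measurable
  moreover have "integrable P (\<lambda>\<omega>. g (int k) \<omega> \<bullet> ?V \<omega>)"
    by (rule g_inner_integrable[OF k' _ V]) measurable
  ultimately show "integrable P (\<lambda>\<omega>. (g (int k) \<omega> - ?drift \<omega>) \<bullet> ?V \<omega>)"
    by (simp add: inner_diff_left[of "g _ _"])
  \<comment> \<open>\<open>estimator_martingale\<close> asks for a bound on the test vector at every
    history, not merely at those that are realised.\<close>
  have iterate_in: "iterate k h \<in> Z" for h using z_start(2) proj_in by (cases k) auto
  have "(\<integral>\<omega>. (g (int k) \<omega> - ?drift \<omega>) \<bullet> (iterate k (hist k \<omega>) - dual k (hist k \<omega>)) \<partial>P) = 0"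
    by (rule estimator_martingale[OF k borel_measurable_diff[OF iterate_measurable[OF subset_refl] dual_measurable[OF subset_refl]]
        diameter_bound[OF iterate_in dual_in]])
  also have "(\<integral>\<omega>. (g (int k) \<omega> - ?drift \<omega>) \<bullet> (iterate k (hist k \<omega>) - dual k (hist k \<omega>)) \<partial>P)
      = (\<integral>\<omega>. (g (int k) \<omega> - ?drift \<omega>) \<bullet> ?V \<omega> \<partial>P)"
    using k by (intro Bochner_Integration.integral_cong) (auto simp: iterate_hist dual_seq_def)
  finally show "(\<integral>\<omega>. (g (int k) \<omega> - ?drift \<omega>) \<bullet> ?V \<omega> \<partial>P) = 0" .
qed

lemma second_moment_sum:
  assumes "6 * \<gamma>\<^sup>2 * n\<^sup>2 * M\<^sup>2 / \<tau>\<^sup>2 = \<alpha>" "\<alpha> < 1"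
  shows "(\<Sum>k\<le>N. \<integral>\<omega>. (norm (g (int k) \<omega>))\<^sup>2 \<partial>P)
    \<le> ((\<integral>\<omega>. (norm (g 0 \<omega>))\<^sup>2 \<partial>P)
        + real N * (12 * n\<^sup>2 * (\<sigma>\<^sup>2 + \<Delta>\<^sup>2) / \<tau>\<^sup>2 + 12 * n\<^sup>2 * M\<^sup>2)) / (1 - \<alpha>)"
proof -
  have "0 \<le> \<alpha>" using assms(1) by (auto intro!: divide_nonneg_nonneg)
  moreover have "(\<integral>\<omega>. (norm (g (int (Suc k)) \<omega>))\<^sup>2 \<partial>P) \<le> \<alpha> * (\<integral>\<omega>. (norm (g (int k) \<omega>))\<^sup>2 \<partial>P)
      + (12 * n\<^sup>2 * (\<sigma>\<^sup>2 + \<Delta>\<^sup>2) / \<tau>\<^sup>2 + 12 * n\<^sup>2 * M\<^sup>2)" if "k < N" for k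
    using g_second_moment_recursion[of "int (Suc k)"] that assms(1) by simp
  ultimately show ?thesis
    using sum_le_of_contraction[of N "\<lambda>k. \<integral>\<omega>. (norm (g (int k) \<omega>))\<^sup>2 \<partial>P" \<alpha>] assms(2) by simp
qed

text \<open>\<open>gap\<close> enters through its upper bounds alone, so the result applies to the
  gap of the original function although the locale works with its extension by zero.\<close>

lemma expected_gap:
  assumes gap: "\<And>\<omega> C. \<omega> \<in> space P \<Longrightarrow>
      (\<And>u. u \<in> Z \<Longrightarrow> \<phi> (fst (zbar \<omega>), snd u) - \<phi> (fst u, snd (zbar \<omega>)) \<le> C) \<Longrightarrow> gap \<omega> \<le> C"
    and zbar: "\<And>\<omega>. zbar \<omega> = (1 / (real N + 1)) *\<^sub>R (\<Sum>k\<le>N. z (int k) \<omega>)"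
    and \<alpha>: "6 * \<gamma>\<^sup>2 * n\<^sup>2 * M\<^sup>2 / \<tau>\<^sup>2 = \<alpha>" "\<alpha> < 1"
  shows "(\<integral>\<omega>. gap \<omega> \<partial>P) \<le> 3 * \<Omega>\<^sup>2 / (2 * \<gamma> * (real N + 1))
      + 3 * \<gamma> / (2 * (real N + 1) * (1 - \<alpha>)) * (\<integral>\<omega>. (norm (g 0 \<omega>))\<^sup>2 \<partial>P)
      + 3 * \<gamma> / (2 * (1 - \<alpha>)) * (12 * n\<^sup>2 * (\<sigma>\<^sup>2 + \<Delta>\<^sup>2) / \<tau>\<^sup>2 + 12 * n\<^sup>2 * M\<^sup>2)
      + 2 * \<tau> * M + \<Delta> * \<Omega> * n / \<tau>"
    (is "_ \<le> ?A + ?B * ?m0 + ?D * ?c + ?E + ?F")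
proof (cases "integrable P gap")
  case False
  \<comment> \<open>The Bochner integral of a non-integrable function is 0, and the bound is nonnegative.\<close>
  then have "(\<integral>\<omega>. gap \<omega> \<partial>P) = 0" by (rule not_integrable_integral_eq)
  moreover have "0 \<le> ?A + ?B * ?m0 + ?D * ?c + ?E + ?F"
    using pos nonneg \<alpha>(2) by (intro add_nonneg_nonneg mult_nonneg_nonneg divide_nonneg_nonneg) auto
  ultimately show ?thesis by (simp only:)
next
  case True
  let ?N = "real N + 1"
  define S where "S = (\<Sum>k\<le>N. \<integral>\<omega>. (norm (g (int k) \<omega>))\<^sup>2 \<partial>P)"
  \<comment> \<open>The right side of \<open>linear_regret_le\<close>. It is free of
    \<open>u\<close> and thus dominates the gap before expectations are taken.\<close>
  define R where "R \<omega> = \<Omega>\<^sup>2 / \<gamma>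
      + \<gamma> / 2 * (\<Sum>k\<le>N. (norm (g (int k) \<omega>))\<^sup>2 + (norm (g (int k) \<omega> - drift (z (int k) \<omega>)))\<^sup>2)
      - (\<Sum>k\<le>N. (g (int k) \<omega> - drift (z (int k) \<omega>)) \<bullet> (z (int k) \<omega> - dual_seq k \<omega>))" for \<omega>
  have g2: "integrable P (\<lambda>\<omega>. (norm (g (int k) \<omega>))\<^sup>2)" if "k \<le> N" for k
    using that by (intro g_square_integrable) simp
  note int = g2 centered_estimator(1) dual_term(1)
  have intR: "integrable P R" unfolding R_def[abs_def]
    by (intro Bochner_Integration.integrable_add Bochner_Integration.integrable_diff
        integrable_mult_right Bochner_Integration.integrable_sum) (use int in auto)
  have "(\<integral>\<omega>. gap \<omega> \<partial>P) \<le> (\<integral>\<omega>. ?E + ?F + 1 / ?N * R \<omega> \<partial>P)"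
  proof (rule integral_mono[OF True])
    fix \<omega> assume \<omega>: "\<omega> \<in> space P"
    show "gap \<omega> \<le> ?E + ?F + 1 / ?N * R \<omega>"
    proof (rule gap[OF \<omega>])
      fix u assume u: "u \<in> Z"
      have "1 / ?N * (\<Sum>k\<le>N. drift (z (int k) \<omega>) \<bullet> (z (int k) \<omega> - u)) \<le> 1 / ?N * R \<omega>"
        unfolding R_def by (intro mult_left_mono linear_regret_le u \<omega>) simp
      then show "\<phi> (fst (zbar \<omega>), snd u) - \<phi> (fst u, snd (zbar \<omega>)) \<le> ?E + ?F + 1 / ?N * R \<omega>"
        using gap_le_regret[OF u \<omega>] unfolding zbar by linarith
    qed
  qed (use intR in simp)
  also have "\<dots> = ?E + ?F + 1 / ?N * (\<integral>\<omega>. R \<omega> \<partial>P)"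
    using intR prob_space by simp
  also have "\<dots> \<le> ?E + ?F + 1 / ?N * (3 * \<Omega>\<^sup>2 / (2 * \<gamma>) + 3 * \<gamma> / 2 * S)"
  proof (intro add_left_mono mult_left_mono)
    let ?S1 = "\<lambda>\<omega>. \<Sum>k\<le>N. (norm (g (int k) \<omega>))\<^sup>2 + (norm (g (int k) \<omega> - drift (z (int k) \<omega>)))\<^sup>2"
    let ?S2 = "\<lambda>\<omega>. \<Sum>k\<le>N. (g (int k) \<omega> - drift (z (int k) \<omega>)) \<bullet> (z (int k) \<omega> - dual_seq k \<omega>)"
    have "integrable P ?S1" "integrable P ?S2"
      by (intro Bochner_Integration.integrable_sum Bochner_Integration.integrable_add int; simp)+
    then have "(\<integral>\<omega>. R \<omega> \<partial>P) = \<Omega>\<^sup>2 / \<gamma> + \<gamma> / 2 * (\<integral>\<omega>. ?S1 \<omega> \<partial>P) - (\<integral>\<omega>. ?S2 \<omega> \<partial>P)"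
      unfolding R_def using prob_space by simp
    also have "(\<integral>\<omega>. ?S2 \<omega> \<partial>P) = 0"
      using int dual_term(2) by (subst Bochner_Integration.integral_sum) auto
    also have "(\<integral>\<omega>. ?S1 \<omega> \<partial>P) = (\<Sum>k\<le>N. (\<integral>\<omega>. (norm (g (int k) \<omega>))\<^sup>2 \<partial>P)
        + (\<integral>\<omega>. (norm (g (int k) \<omega> - drift (z (int k) \<omega>)))\<^sup>2 \<partial>P))"
      using int by (subst Bochner_Integration.integral_sum) auto
    also have "\<Omega>\<^sup>2 / \<gamma> + \<gamma> / 2 * \<dots> - 0 = \<Omega>\<^sup>2 / \<gamma> + \<gamma> / 2 * \<dots>"
      by simp
    also have "\<dots> \<le> \<Omega>\<^sup>2 / \<gamma> + \<gamma> / 2 * (\<Sum>k\<le>N. 2 * (\<integral>\<omega>. (norm (g (int k) \<omega>))\<^sup>2 \<partial>P))"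
      using pos centered_estimator(2) by (intro add_left_mono mult_left_mono sum_mono) auto
    also have "\<dots> = \<Omega>\<^sup>2 / \<gamma> + \<gamma> * S"
      by (simp add: S_def flip: sum_distrib_left)
    \<comment> \<open>The two regrets give the coefficients 1 and 1; they are enlarged to the 3/2 of
      the stated bound.\<close>
    also have "\<dots> \<le> 3 * \<Omega>\<^sup>2 / (2 * \<gamma>) + 3 * \<gamma> / 2 * S"
      using pos by (intro add_mono) (auto simp: S_def field_simps intro!: sum_nonneg)
    finally show "(\<integral>\<omega>. R \<omega> \<partial>P) \<le> 3 * \<Omega>\<^sup>2 / (2 * \<gamma>) + 3 * \<gamma> / 2 * S" .
  qed simp
  \<comment> \<open>The recursion adds its constant \<open>N\<close> times; enlarging this to
    \<open>N + 1\<close> lets it cancel against the averaging factor.\<close>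
  also have "\<dots> \<le> ?E + ?F + 1 / ?N * (3 * \<Omega>\<^sup>2 / (2 * \<gamma>) + 3 * \<gamma> / 2 * ((?m0 + ?N * ?c) / (1 - \<alpha>)))"
  proof (intro add_left_mono mult_left_mono)
    have "S \<le> (?m0 + real N * ?c) / (1 - \<alpha>)"
      unfolding S_def by (rule second_moment_sum[OF \<alpha>])
    also have "\<dots> \<le> (?m0 + ?N * ?c) / (1 - \<alpha>)"
      using \<alpha>(2) by (intro divide_right_mono add_left_mono mult_right_mono) auto
    finally show "S \<le> (?m0 + ?N * ?c) / (1 - \<alpha>)" .
  qed (use pos in auto)
  also have "1 / ?N * (3 * \<Omega>\<^sup>2 / (2 * \<gamma>) + 3 * \<gamma> / 2 * ((?m0 + ?N * ?c) / (1 - \<alpha>))) = ?A + ?B * ?m0 + ?D * ?c"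
  proof -
    have "1 / m * (3 * \<Omega>\<^sup>2 / (2 * \<gamma>) + 3 * \<gamma> / 2 * ((a + m * c) / b))
        = 3 * \<Omega>\<^sup>2 / (2 * \<gamma> * m) + 3 * \<gamma> / (2 * m * b) * a + 3 * \<gamma> / (2 * b) * c"
      if "m > 0" "b > 0" for m a b c :: real
      using that pos by (simp add: field_simps)
    from this[of ?N "1 - \<alpha>" ?m0 ?c] show ?thesis using \<alpha>(2) by linarith
  qed
  finally show ?thesis by simp
qed

end

section \<open>The bound for the residual-feedback scheme\<close>

theorem theorem3:
  fixes X :: "(real ^ 'nx) set" and Y :: "(real ^ 'ny) set"
    and Z U :: "((real ^ 'nx) \<times> (real ^ 'ny)) set"
    and \<phi> \<delta> :: "(real ^ 'nx) \<times> (real ^ 'ny) \<Rightarrow> real"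
    and \<phi>t :: "(real ^ 'nx) \<times> (real ^ 'ny) \<Rightarrow> real \<Rightarrow> real"
    and P :: "'w measure"
    and z e g :: "int \<Rightarrow> 'w \<Rightarrow> (real ^ 'nx) \<times> (real ^ 'ny)"
    and \<xi> :: "int \<Rightarrow> 'w \<Rightarrow> real"
    and z0 :: "(real ^ 'nx) \<times> (real ^ 'ny)"
    and M \<Omega> \<Delta> \<sigma> \<tau> \<gamma> \<alpha> :: real and n N :: nat
  assumes "compact X" "convex X" "compact Y" "convex Y"
    and "Z = X \<times> Y" and "\<Omega> = diameter Z" and "n = CARD('nx) + CARD('ny)"
    and "M > 0" "\<Delta> > 0" "\<sigma> > 0" "\<tau> > 0" "\<gamma> > 0"
    and "U = closed_neighbourhood \<tau> Z"
    and "convex_concave_on U \<phi>" and "M-lipschitz_on U \<phi>"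
    and "\<And>p s. p \<in> U \<Longrightarrow> \<phi>t p s = \<phi> p + s + \<delta> p"
    and "\<delta> \<in> borel_measurable (restrict_space borel U)"
    and "\<And>p. p \<in> U \<Longrightarrow> \<bar>\<delta> p\<bar> \<le> \<Delta>"
    and "prob_space P"
    and "\<And>k. k \<in> {-1..int N} \<Longrightarrow> integrable P (\<lambda>\<omega>. (\<xi> k \<omega>)\<^sup>2)"
    and "\<And>k. k \<in> {-1..int N} \<Longrightarrow> (\<integral>\<omega>. \<xi> k \<omega> \<partial>P) = 0"
    and "\<And>k. k \<in> {-1..int N} \<Longrightarrow> (\<integral>\<omega>. (\<xi> k \<omega>)\<^sup>2 \<partial>P) \<le> \<sigma>\<^sup>2"
    and "\<And>k \<omega>. k \<in> {-1..int N} \<Longrightarrow> \<omega> \<in> space P \<Longrightarrow> e k \<omega> \<in> sphere 0 1"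
    and "\<And>k. k \<in> {0..int N} \<Longrightarrow> distr P borel (e k) = uniform_sphere"
    and "\<And>k. k \<in> {0..int N} \<Longrightarrow> independent_rvs P borel (e k) borel (\<xi> k)"
    and "\<And>k. k \<in> {0..int N} \<Longrightarrow>
           independent_rvs P borel (\<lambda>\<omega>. (e k \<omega>, \<xi> k \<omega>))
             (Pi\<^sub>M {-1..<k} (\<lambda>_. borel)) (\<lambda>\<omega>. \<lambda>j\<in>{-1..<k}. (z j \<omega>, e j \<omega>, \<xi> j \<omega>))"
    and "\<And>\<omega>. \<omega> \<in> space P \<Longrightarrow> z (-1) \<omega> \<in> Z"
    and "z0 \<in> Z" and "\<And>\<omega>. \<omega> \<in> space P \<Longrightarrow> z 0 \<omega> = z0"
    and "\<And>k \<omega>. k \<in> {0..int N} \<Longrightarrow> \<omega> \<in> space P \<Longrightarrow>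
           g k \<omega> = (real n * (\<phi>t (z k \<omega> + \<tau> *\<^sub>R e k \<omega>) (\<xi> k \<omega>)
                       - \<phi>t (z (k - 1) \<omega> + \<tau> *\<^sub>R e (k - 1) \<omega>) (\<xi> (k - 1) \<omega>)) / \<tau>)
                    *\<^sub>R (fst (e k \<omega>), - snd (e k \<omega>))"
    and "\<And>k \<omega>. k \<in> {0..int N} \<Longrightarrow> \<omega> \<in> space P \<Longrightarrow>
           z (k + 1) \<omega> = prox Z (z k \<omega>) (\<gamma> *\<^sub>R g k \<omega>)"
    and "\<alpha> = 6 * \<gamma>\<^sup>2 * (real n)\<^sup>2 * M\<^sup>2 / \<tau>\<^sup>2" and "\<alpha> < 1"
  shows "(\<integral>\<omega>. eps_sad X Y \<phi> ((1 / (real N + 1)) *\<^sub>R (\<Sum>i=0..int N. z i \<omega>)) \<partial>P)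
    \<le> 3 * \<Omega>\<^sup>2 / (2 * \<gamma> * (real N + 1))
      + 3 * \<gamma> / (2 * (real N + 1) * (1 - \<alpha>)) * (\<integral>\<omega>. (norm (g 0 \<omega>))\<^sup>2 \<partial>P)
      + 3 * \<gamma> / (2 * (1 - \<alpha>)) *
          (12 * (real n)\<^sup>2 * (\<sigma>\<^sup>2 + \<Delta>\<^sup>2) / \<tau>\<^sup>2 + 12 * (real n)\<^sup>2 * M\<^sup>2)
      + 2 * \<tau> * M + \<Delta> * \<Omega> * real n / \<tau>"
proof -
  interpret prob_space P by fact
  have Z: "Z = X \<times> Y" by fact
  note U = \<open>U = closed_neighbourhood \<tau> Z\<close>
  have sub: "w + \<tau> *\<^sub>R d \<in> U" if "w \<in> Z" "norm d = 1" for w d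
    unfolding U using that \<open>\<tau> > 0\<close> by (simp add: add_mem_closed_neighbourhood)
  have ZU: "Z \<subseteq> U"
    using add_mem_closed_neighbourhood[of _ Z 0 \<tau>] \<open>\<tau> > 0\<close> unfolding U by auto
  have Zp: "compact Z" "closed Z" "convex Z" "Z \<noteq> {}"
    unfolding Z using \<open>z0 \<in> Z\<close> \<open>compact X\<close> \<open>compact Y\<close> \<open>convex X\<close> \<open>convex Y\<close>
    by (auto intro!: compact_Times convex_Times compact_imp_closed simp: Z)
  have "compact U" unfolding U by (rule compact_closed_neighbourhood[OF \<open>compact Z\<close>])
  then have Ub: "U \<in> sets borel" by (rule borel_compact)
  define \<phi>' where "\<phi>' p = (if p \<in> U then \<phi> p else 0)" for p
  define \<delta>' where "\<delta>' p = (if p \<in> U then \<delta> p else 0)" for p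
  have cont: "continuous_on U \<phi>"
    using \<open>M-lipschitz_on U \<phi>\<close> by (rule lipschitz_on_continuous_on)
  have \<phi>'_meas: "\<phi>' \<in> borel_measurable borel"
    unfolding \<phi>'_def[abs_def] by (rule borel_measurable_continuous_on_if[OF Ub cont]) simp
  have "\<delta>' = (\<lambda>p. indicator U p *\<^sub>R \<delta> p)"
    by (auto simp: \<delta>'_def fun_eq_iff)
  then have \<delta>'_meas: "\<delta>' \<in> borel_measurable borel"
    using \<open>\<delta> \<in> borel_measurable (restrict_space borel U)\<close> Ub
    by (simp add: borel_measurable_restrict_space_iff)
  \<comment> \<open>The bound comes from compactness of \<open>U\<close> and serves integrability;
    it does not enter the final estimate.\<close>
  obtain K where K: "\<And>p. \<bar>\<phi>' p\<bar> \<le> K"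
  proof -
    have "bounded (\<phi> ` U)"
      by (intro compact_imp_bounded compact_continuous_image cont \<open>compact U\<close>)
    then obtain K where "\<forall>x\<in>\<phi> ` U. norm x \<le> K" unfolding bounded_iff by blast
    then show thesis by (intro that[of "max K 0"]) (auto simp: \<phi>'_def intro: max.coboundedI1)
  qed
  have step: "z (k + 1) \<omega> = closest_point Z (z k \<omega> - \<gamma> *\<^sub>R g k \<omega>)"
    if "k \<in> {0..int N}" "\<omega> \<in> space P" for k \<omega>
    using assms(31)[OF that] Zp by (simp add: prox_eq_closest_point)
  have z_mem: "z k \<omega> \<in> Z" if "k \<in> {-1..int N}" "\<omega> \<in> space P" for k \<omega>
  proof -
    consider "k = -1" | "k = 0" | "k - 1 \<in> {0..int N}" using \<open>k \<in> {-1..int N}\<close> by force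
    then show ?thesis
    proof cases
      case 3
      then show ?thesis
        using step[of "k - 1" \<omega>] closest_point_in_set[OF Zp(2,4)] that by simp
    qed (use assms(27,28,29) that in auto)
  qed
  have e1: "norm (e k \<omega>) = 1" if "k \<in> {-1..int N}" "\<omega> \<in> space P" for k \<omega>
    using assms(23)[OF that] by simp
  have query: "\<phi>t (z k \<omega> + \<tau> *\<^sub>R e k \<omega>) (\<xi> k \<omega>)
      = \<phi>' (z k \<omega> + \<tau> *\<^sub>R e k \<omega>) + \<xi> k \<omega> + \<delta>' (z k \<omega> + \<tau> *\<^sub>R e k \<omega>)"
    if "k \<in> {-1..int N}" "\<omega> \<in> space P" for k \<omega>
    using assms(16) sub[OF z_mem[OF that] e1[OF that]] by (simp add: \<phi>'_def \<delta>'_def)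
  interpret residual_feedback P X Y \<phi>' \<delta>' z e g \<xi> z0 "real n" M K \<Delta> \<sigma> \<tau> \<gamma> \<Omega> N
  proof unfold_locales
    show "convex_concave_on (closed_neighbourhood \<tau> (X \<times> Y)) \<phi>'"
      using convex_concave_on_transform[OF \<open>convex_concave_on U \<phi>\<close>, of \<phi>'] by (simp add: \<phi>'_def U Z)
    show "M-lipschitz_on (closed_neighbourhood \<tau> (X \<times> Y)) \<phi>'"
      using \<open>M-lipschitz_on U \<phi>\<close> by (simp add: \<phi>'_def U Z)
    show "\<bar>\<delta>' p\<bar> \<le> \<Delta>" for p
      using assms(18)[of p] \<open>\<Delta> > 0\<close> by (simp add: \<delta>'_def)
    show "g k \<omega> = (real n * ((\<phi>' (z k \<omega> + \<tau> *\<^sub>R e k \<omega>) + \<xi> k \<omega> + \<delta>' (z k \<omega> + \<tau> *\<^sub>R e k \<omega>))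
        - (\<phi>' (z (k - 1) \<omega> + \<tau> *\<^sub>R e (k - 1) \<omega>) + \<xi> (k - 1) \<omega>
          + \<delta>' (z (k - 1) \<omega> + \<tau> *\<^sub>R e (k - 1) \<omega>))) / \<tau>) *\<^sub>R flip (e k \<omega>)"
      if "k \<in> {0..int N}" "\<omega> \<in> space P" for k \<omega>
      using assms(30)[OF that] query[of k \<omega>] query[of "k - 1" \<omega>] that by (simp add: flip_def)
    show "z (k + 1) \<omega> = closest_point (X \<times> Y) (z k \<omega> - \<gamma> *\<^sub>R g k \<omega>)"
      if "k \<in> {0..int N}" "\<omega> \<in> space P" for k \<omega>
      using step[OF that] by (simp add: Z)
    show "z (-1) \<omega> \<in> X \<times> Y" if "\<omega> \<in> space P" for \<omega>
      using assms(27)[OF that] by (simp add: Z)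
    show "z0 \<in> X \<times> Y" using \<open>z0 \<in> Z\<close> by (simp add: Z)
    show "real n = real DIM((real ^ 'nx) \<times> (real ^ 'ny))" using assms(7) by simp
  qed (fact assms \<phi>'_meas \<delta>'_meas K e1 | use assms(6) Z in simp)+
  define zbar where "zbar \<omega> = (1 / (real N + 1)) *\<^sub>R (\<Sum>k\<le>N. z (int k) \<omega>)" for \<omega>
  \<comment> \<open>Integer indices accommodate the preceding query with index -1; the average uses
    nonnegative ones and is reindexed by naturals.\<close>
  have zbar: "(1 / (real N + 1)) *\<^sub>R (\<Sum>i=0..int N. z i \<omega>) = zbar \<omega>" for \<omega>
    unfolding zbar_def
    by (intro arg_cong[where f = "\<lambda>s. _ *\<^sub>R s"] sum.reindex_bij_witness[of _ int nat]) auto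
  have zbar_in: "zbar \<omega> \<in> Z" if "\<omega> \<in> space P" for \<omega>
    unfolding zbar_def scaleR_sum_right
    by (rule convex_sum[OF _ Zp(3)]) (use z_mem[OF _ that] in \<open>auto simp: field_simps\<close>)
  \<comment> \<open>The mixed points formed from the average and \<open>u\<close> lie in
    \<open>Z\<close>, hence in \<open>U\<close>, where the extension agrees with
    \<open>\<phi>\<close>.\<close>
  have gap: "eps_sad X Y \<phi> (zbar \<omega>) \<le> C"
    if \<omega>: "\<omega> \<in> space P"
      and C: "\<And>u. u \<in> X \<times> Y \<Longrightarrow> \<phi>' (fst (zbar \<omega>), snd u) - \<phi>' (fst u, snd (zbar \<omega>)) \<le> C" for \<omega> C
  proof (rule eps_sad_le)
    fix u assume u: "u \<in> X \<times> Y"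
    then have "(fst (zbar \<omega>), snd u) \<in> U" "(fst u, snd (zbar \<omega>)) \<in> U"
      using zbar_in[OF \<omega>] ZU by (auto simp: Z mem_Times_iff)
    then show "\<phi> (fst (zbar \<omega>), snd u) - \<phi> (fst u, snd (zbar \<omega>)) \<le> C"
      using C[OF u] by (simp add: \<phi>'_def)
  qed (use Zp(4) Z in auto)
  show ?thesis
    unfolding zbar by (rule expected_gap[OF gap zbar_def]) (use assms(32,33) in simp_all)
qed

end
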